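(* Let $G$ be a graph on $n$ vertices with maximum degree $\Delta>1$, with one qubit per vertex, and let $\mathbf H(t)=\sum_e u_e(t)\mathbf h_e$ where each $\mathbf h_e$ is time-independent and acts non-trivially only on the two endpoints of edge $e$, with $\|u_e(t)\mathbf h_e\|\le g$ for every edge $e$ and all $0\le t\le T$. Let $\mathbf U(t)$ be the associated unitary evolution, let $|\psi_0\rangle=|s_1\rangle\otimes\cdots\otimes|s_n\rangle$ be a product state, and $|\psi_T\rangle=\mathbf U(T)|\psi_0\rangle$. Suppose $$T\le\frac{\kappa_1}{8g\,\Delta^{\frac{2-\kappa_1}{\kappa_1}}\log\Delta}\log n$$ for a constant $0<\kappa_1<1$. Let $p(\mathbf x)$ be the distribution on $\{0,1\}^n$ obtained by measuring $|\psi_T\rangle$ in the computational basis, and let $m=\sum_i\langle\psi_T|\mathbf Z_i|\psi_T\rangle$. Then for any $c>0$ and any $\kappa_1/2<\kappa_2<1/2$, $$\Pr_{\mathbf x\sim p}\Big[\big|w_H(\mathbf x)-\big(\tfrac n2-\tfrac m2\big)\big|\ge c\,n^{\frac12+\kappa_2}\Big]\le\frac{3}{2c^2}\,n^{-(2\kappa_2-\kappa_1)}.$$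
   Context: $\|\cdot\|$ is the spectral norm; the unitary evolution solves $i\frac{d}{dt}\mathbf U(t)=\mathbf H(t)\mathbf U(t)$, $\mathbf U(0)=\mathbf I$. $\mathbf Z_i$ is the Pauli-$z$ operator on qubit $i$. $w_H(\mathbf x)$ is the Hamming weight (number of nonzero coordinates) of $\mathbf x$. Logarithms are natural. *)

theory Defs
  imports "HOL-Analysis.Analysis"
begin

text \<open>n-qubit register. Computational basis states |x> with x in {0,1}^n are encoded
  as the set of qubits (vertices 0..n-1) that are in state |1>. So the basis is
  Pow {..<n}, and the Hamming weight of x is card x.
  Vectors are functions basis => complex, operators are matrices basis => basis => complex.\<close>

definition basis :: "nat \<Rightarrow> nat set set" where
  "basis n = Pow {..<n}"

definition mat_vec :: "nat \<Rightarrow> (nat set \<Rightarrow> nat set \<Rightarrow> complex) \<Rightarrow> (nat set \<Rightarrow> complex) \<Rightarrow> (nat set \<Rightarrow> complex)" where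
  "mat_vec n A v = (\<lambda>x. \<Sum>y\<in>basis n. A x y * v y)"

definition mat_mul :: "nat \<Rightarrow> (nat set \<Rightarrow> nat set \<Rightarrow> complex) \<Rightarrow> (nat set \<Rightarrow> nat set \<Rightarrow> complex) \<Rightarrow> (nat set \<Rightarrow> nat set \<Rightarrow> complex)" where
  "mat_mul n A B = (\<lambda>x y. \<Sum>z\<in>basis n. A x z * B z y)"

definition vnorm :: "nat \<Rightarrow> (nat set \<Rightarrow> complex) \<Rightarrow> real" where
  "vnorm n v = sqrt (\<Sum>x\<in>basis n. (cmod (v x))\<^sup>2)"

definition opnorm :: "nat \<Rightarrow> (nat set \<Rightarrow> nat set \<Rightarrow> complex) \<Rightarrow> real" where
  "opnorm n A = Sup {vnorm n (mat_vec n A v) | v. vnorm n v = 1}"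

definition id_mat :: "nat set \<Rightarrow> nat set \<Rightarrow> complex" where
  "id_mat = (\<lambda>x y. if x = y then 1 else 0)"

definition hermitian :: "nat \<Rightarrow> (nat set \<Rightarrow> nat set \<Rightarrow> complex) \<Rightarrow> bool" where
  "hermitian n A \<longleftrightarrow> (\<forall>x\<in>basis n. \<forall>y\<in>basis n. A y x = cnj (A x y))"

text \<open>A acts non-trivially only on the qubits in S: A = k \<otimes> I for some operator k on
  the qubits in S (k is indexed by the basis states of S, i.e. subsets of S).\<close>
definition acts_only_on :: "nat \<Rightarrow> nat set \<Rightarrow> (nat set \<Rightarrow> nat set \<Rightarrow> complex) \<Rightarrow> bool" where
  "acts_only_on n S A \<longleftrightarrow> (\<exists>k :: nat set \<Rightarrow> nat set \<Rightarrow> complex.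
     \<forall>x\<in>basis n. \<forall>y\<in>basis n.
       A x y = (if x - S = y - S then k (x \<inter> S) (y \<inter> S) else 0))"

definition pauliZ :: "nat \<Rightarrow> nat set \<Rightarrow> nat set \<Rightarrow> complex" where
  "pauliZ i = (\<lambda>x y. if x = y then (if i \<in> x then -1 else 1) else 0)"

definition expval :: "nat \<Rightarrow> (nat set \<Rightarrow> nat set \<Rightarrow> complex) \<Rightarrow> (nat set \<Rightarrow> complex) \<Rightarrow> complex" where
  "expval n A \<psi> = (\<Sum>x\<in>basis n. \<Sum>y\<in>basis n. cnj (\<psi> x) * A x y * \<psi> y)"

text \<open>Product state |s_1> \<otimes> ... \<otimes> |s_n>, s i False = amplitude of |0>, s i True = of |1>.\<close>
definition product_state :: "nat \<Rightarrow> (nat \<Rightarrow> bool \<Rightarrow> complex) \<Rightarrow> nat set \<Rightarrow> complex" where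
  "product_state n s = (\<lambda>x. \<Prod>i<n. s i (i \<in> x))"

definition simple_graph :: "nat \<Rightarrow> nat set set \<Rightarrow> bool" where
  "simple_graph n E \<longleftrightarrow> (\<forall>e\<in>E. \<exists>a b. a < n \<and> b < n \<and> a \<noteq> b \<and> e = {a, b})"

definition degree :: "nat set set \<Rightarrow> nat \<Rightarrow> nat" where
  "degree E v = card {e\<in>E. v \<in> e}"

definition max_degree :: "nat \<Rightarrow> nat set set \<Rightarrow> nat" where
  "max_degree n E = Max (insert 0 ((\<lambda>v. degree E v) ` {..<n}))"

end

theory Submission
  imports Defs "HOL-Library.Poly_Mapping"
begin

text \<open>By Chebyshev's inequality it suffices to bound the variance of the magnetization
  \<open>Z = \<Sum>\<^sub>i Z\<^sub>i\<close> in \<open>\<psi>\<^sub>T\<close>, that is, of the Heisenberg operator \<open>A = U\<^sup>* Z U\<close> in the product state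
  \<open>\<psi>\<^sub>0\<close>. If \<open>p\<^sub>i\<close> projects qubit \<open>i\<close> onto \<open>s\<^sub>i\<close>, then an Efron-Stein inequality bounds this variance by
  \<open>\<Sum>\<^sub>i \<parallel>(1 - p\<^sub>i) A \<psi>\<^sub>0\<parallel>\<^sup>2\<close>, and each term is at most a quarter of the squared norm of
  \<open>[2 p\<^sub>i - 1, A]\<close>. The supremum of the norms of the commutators of the evolving observable with contractions
  supported on an edge or on a single vertex is at most \<open>4\<close> for \<open>Z\<close>, and it grows at rate at most
  \<open>4 g (\<Delta> - 1)\<close>, because only the at most \<open>2 (\<Delta> - 1)\<close> edges crossing the boundary of the support
  contribute. Hence the variance is at most \<open>4 n exp (8 g (\<Delta> - 1) T)\<close>, and
  \<open>\<Delta> - 1 \<le> \<Delta> ln \<Delta>\<close> turns the bound on \<open>T\<close> into \<open>8 g (\<Delta> - 1) T \<le> \<kappa>\<^sub>1 ln n\<close>. Summing over all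
  vertices at once avoids counting paths, and so loses no constant in the exponent.

  Operators are bounded real-linear maps on finitely supported complex functions, which form a real
  inner product space independent of \<open>n\<close>; the generator \<open>- \<i> H\<close> becomes a skew-symmetric map.\<close>

section \<open>Finitely supported functions as a real inner product space\<close>

instantiation poly_mapping :: (type, real_vector) real_vector
begin

lift_definition scaleR_poly_mapping :: "real \<Rightarrow> ('a \<Rightarrow>\<^sub>0 'b) \<Rightarrow> ('a \<Rightarrow>\<^sub>0 'b)"
  is "\<lambda>r f x. r *\<^sub>R f x"
  by (erule finite_subset[rotated]) auto

instance
  by standard (transfer, simp add: algebra_simps)+

end

lemma lookup_scaleR: "poly_mapping.lookup (r *\<^sub>R f) x = r *\<^sub>R poly_mapping.lookup f x"
  by (rule scaleR_poly_mapping.rep_eq[THEN fun_cong])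

instantiation poly_mapping :: (type, real_inner) real_inner
begin

text \<open>For complex values the pointwise \<open>\<bullet>\<close> is the real part of the
  Hermitian product, so this is the real part of the usual inner product of state vectors and
  induces the same norm.\<close>

definition inner_poly_mapping :: "('a \<Rightarrow>\<^sub>0 'b) \<Rightarrow> ('a \<Rightarrow>\<^sub>0 'b) \<Rightarrow> real"
  where "inner_poly_mapping f g = (\<Sum>x\<in>Poly_Mapping.keys f. poly_mapping.lookup f x \<bullet> poly_mapping.lookup g x)"

definition norm_poly_mapping :: "('a \<Rightarrow>\<^sub>0 'b) \<Rightarrow> real"
  where "norm_poly_mapping f = sqrt (f \<bullet> f)"

definition dist_poly_mapping :: "('a \<Rightarrow>\<^sub>0 'b) \<Rightarrow> ('a \<Rightarrow>\<^sub>0 'b) \<Rightarrow> real"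
  where "dist_poly_mapping f g = norm (f - g)"

definition sgn_poly_mapping :: "('a \<Rightarrow>\<^sub>0 'b) \<Rightarrow> ('a \<Rightarrow>\<^sub>0 'b)"
  where "sgn_poly_mapping f = f /\<^sub>R norm f"

definition uniformity_poly_mapping :: "(('a \<Rightarrow>\<^sub>0 'b) \<times> ('a \<Rightarrow>\<^sub>0 'b)) filter"
  where "uniformity_poly_mapping = (INF e\<in>{0<..}. principal {(f, g). dist f g < e})"

definition open_poly_mapping :: "('a \<Rightarrow>\<^sub>0 'b) set \<Rightarrow> bool"
  where "open_poly_mapping S \<longleftrightarrow>
    (\<forall>f\<in>S. \<forall>\<^sub>F (f', g) in uniformity. f' = f \<longrightarrow> g \<in> S)"

text \<open>The definition sums over the support of the left argument only. Passing to a common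
  finite superset makes symmetry and additivity termwise facts.\<close>

lemma inner_poly_mapping_superset:
  assumes "finite K" "Poly_Mapping.keys f \<subseteq> K"
  shows "f \<bullet> g = (\<Sum>x\<in>K. poly_mapping.lookup f x \<bullet> poly_mapping.lookup g x)"
  unfolding inner_poly_mapping_def using assms
  by (intro sum.mono_neutral_left) (auto simp: in_keys_iff)

instance
proof
  fix f g h :: "'a \<Rightarrow>\<^sub>0 'b" and r :: real
  define K where "K = Poly_Mapping.keys f \<union> Poly_Mapping.keys g \<union> Poly_Mapping.keys h
    \<union> Poly_Mapping.keys (f + g) \<union> Poly_Mapping.keys (r *\<^sub>R f)"
  have K: "finite K" "Poly_Mapping.keys f \<subseteq> K" "Poly_Mapping.keys g \<subseteq> K"
    "Poly_Mapping.keys (f + g) \<subseteq> K" "Poly_Mapping.keys (r *\<^sub>R f) \<subseteq> K"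
    by (auto simp: K_def)
  note I = inner_poly_mapping_superset[OF K(1)]
  show "f \<bullet> g = g \<bullet> f"
    using K by (simp add: I inner_commute)
  show "(f + g) \<bullet> h = f \<bullet> h + g \<bullet> h"
    using K by (simp add: I lookup_add inner_add_left sum.distrib)
  show "(r *\<^sub>R f) \<bullet> g = r * (f \<bullet> g)"
    using K by (simp add: I lookup_scaleR sum_distrib_left)
  show "0 \<le> f \<bullet> f"
    by (simp add: inner_poly_mapping_def sum_nonneg)
  show "f \<bullet> f = 0 \<longleftrightarrow> f = 0"
    by (auto simp: inner_poly_mapping_def sum_nonneg_eq_0_iff in_keys_iff poly_mapping_eq_iff fun_eq_iff)
qed (simp_all add: dist_poly_mapping_def sgn_poly_mapping_def uniformity_poly_mapping_def
      open_poly_mapping_def norm_poly_mapping_def)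

end

section \<open>Growth of commutators\<close>

text \<open>A Gronwall inequality for functions that need not be differentiable, such as norms and
  suprema of norms: only forward difference quotients are controlled. The function is compared with
  a slightly faster exponential, up to the last time at which the comparison holds.\<close>

lemma dini_gronwall:
  fixes f :: "real \<Rightarrow> real"
  assumes cont: "continuous_on {0..T} f" and T: "0 \<le> T"
    and nonneg: "\<And>s. s \<in> {0..T} \<Longrightarrow> 0 \<le> f s"
    and step: "\<And>s \<epsilon>. 0 \<le> s \<Longrightarrow> s < T \<Longrightarrow> 0 < \<epsilon> \<Longrightarrow>
      \<exists>d>0. \<forall>h. 0 < h \<and> h < d \<and> s + h \<le> T \<longrightarrow> f (s + h) \<le> f s + h * (a * f s + \<epsilon>)"
    and a: "0 \<le> a"
  shows "f T \<le> f 0 * exp (a * T)"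
proof -
  \<comment> \<open>The \<open>\<eta>\<close> in the initial value keeps the comparison function
    positive even if \<open>f 0 = 0\<close>; the \<open>\<eta>\<close> in the rate leaves room for
    the error term. Both disappear in the limit at the end.\<close>
  have main: "f T \<le> (f 0 + \<eta>) * exp ((a + \<eta>) * T)" if \<eta>: "0 < \<eta>" for \<eta>
  proof -
    define y where "y = (\<lambda>t. (f 0 + \<eta>) * exp ((a + \<eta>) * t))"
    have f0: "0 \<le> f 0"
      using nonneg T by simp
    have y_pos: "0 < y t" for t
      using f0 \<eta> by (simp add: y_def add_nonneg_pos)
    have y_step: "y s + h * ((a + \<eta>) * y s) \<le> y (s + h)" if "0 \<le> h" for s h
    proof -
      have "y s * (1 + (a + \<eta>) * h) \<le> y s * exp ((a + \<eta>) * h)"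
        using y_pos[of s] by (intro mult_left_mono exp_ge_add_one_self) auto
      also have "\<dots> = y (s + h)"
        by (simp add: y_def exp_add distrib_left)
      finally show ?thesis
        by (simp add: algebra_simps)
    qed
    \<comment> \<open>Times up to which the comparison holds without interruption. Continuity
      carries it to the supremum \<open>\<sigma>\<close>, and the step condition would push it
      beyond any \<open>\<sigma> < T\<close>.\<close>
    define G where "G = {t \<in> {0..T}. \<forall>t'\<in>{0..t}. f t' \<le> y t'}"
    have "0 \<in> G"
      using T f0 \<eta> by (simp add: G_def y_def)
    moreover have G_T: "\<And>t. t \<in> G \<Longrightarrow> t \<le> T"
      by (simp add: G_def)
    ultimately have bdd: "bdd_above G" and ne: "G \<noteq> {}"
      by (auto simp: bdd_above_def)
    define \<sigma> where "\<sigma> = Sup G"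
    have \<sigma>0: "0 \<le> \<sigma>"
      unfolding \<sigma>_def using \<open>0 \<in> G\<close> bdd by (rule cSup_upper)
    have \<sigma>T: "\<sigma> \<le> T"
      unfolding \<sigma>_def using ne G_T by (rule cSup_least)
    have below: "f t \<le> y t" if t: "0 \<le> t" "t < \<sigma>" for t
    proof -
      obtain t' where "t' \<in> G" "t < t'"
        using t(2) less_cSup_iff[OF ne bdd] by (auto simp: \<sigma>_def)
      then show ?thesis
        using t(1) by (simp add: G_def)
    qed
    have at: "f \<sigma> \<le> y \<sigma>"
    proof (cases "\<sigma> = 0")
      case True
      then show ?thesis
        using \<eta> by (simp add: y_def)
    next
      case False
      have "continuous_on {0..\<sigma>} (\<lambda>t. f t - y t)"
        unfolding y_def using continuous_on_subset[OF cont] \<sigma>T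
        by (intro continuous_intros) auto
      then have "((\<lambda>t. f t - y t) \<longlongrightarrow> f \<sigma> - y \<sigma>) (at_left \<sigma>)"
        using False \<sigma>0 by (intro continuous_on_Icc_at_leftD) auto
      moreover have "\<forall>\<^sub>F t in at_left \<sigma>. f t - y t \<le> 0"
        using eventually_at_left_real[of 0 \<sigma>] False \<sigma>0 below
        by (auto elim!: eventually_mono)
      ultimately have "f \<sigma> - y \<sigma> \<le> 0"
        by (rule tendsto_upperbound) simp
      then show ?thesis
        by simp
    qed
    have "\<sigma> = T"
    proof (rule ccontr)
      assume "\<sigma> \<noteq> T"
      then have lt: "\<sigma> < T"
        using \<sigma>T by simp
      \<comment> \<open>The error is taken to be \<open>\<eta> * y \<sigma>\<close>, exactly the
        surplus in the growth rate of \<open>y\<close> at \<open>\<sigma>\<close>.\<close>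
      obtain d where d: "d > 0" and
        dd: "\<And>h. 0 < h \<Longrightarrow> h < d \<Longrightarrow> \<sigma> + h \<le> T \<Longrightarrow>
          f (\<sigma> + h) \<le> f \<sigma> + h * (a * f \<sigma> + \<eta> * y \<sigma>)"
        using step[OF \<sigma>0 lt mult_pos_pos[OF \<eta> y_pos[of \<sigma>]]] by blast
      define k where "k = min (d / 2) (T - \<sigma>)"
      have k: "0 < k" "k < d" "\<sigma> + k \<le> T"
        using d lt by (auto simp: k_def min_def)
      have "f t \<le> y t" if "\<sigma> < t" "t \<le> \<sigma> + k" for t
      proof -
        define h where "h = t - \<sigma>"
        have h: "0 < h" "h < d" "\<sigma> + h \<le> T"
          using that k by (auto simp: h_def)
        have "f (\<sigma> + h) \<le> f \<sigma> + h * (a * f \<sigma> + \<eta> * y \<sigma>)"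
          by (rule dd[OF h])
        also have "\<dots> \<le> y \<sigma> + h * (a * y \<sigma> + \<eta> * y \<sigma>)"
          using at a h \<eta> by (intro add_mono mult_left_mono) auto
        also have "\<dots> \<le> y (\<sigma> + h)"
          using y_step[of h \<sigma>] h by (simp add: algebra_simps)
        finally show ?thesis
          by (simp add: h_def)
      qed
      then have "\<sigma> + k \<in> G"
        using k \<sigma>0 at below by (auto simp: G_def) (metis linorder_neqE_linordered_idom not_le)
      then have "\<sigma> + k \<le> \<sigma>"
        unfolding \<sigma>_def using bdd by (intro cSup_upper)
      then show False
        using k by simp
    qed
    then show ?thesis
      using at by (simp add: y_def)
  qed
  have "((\<lambda>\<eta>. (f 0 + \<eta>) * exp ((a + \<eta>) * T)) \<longlongrightarrow> (f 0 + 0) * exp ((a + 0) * T)) (at_right 0)"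
    by (intro tendsto_intros)
  moreover have "\<forall>\<^sub>F \<eta> in at_right 0. f T \<le> (f 0 + \<eta>) * exp ((a + \<eta>) * T)"
    using main by (auto simp: eventually_at_right_less intro: eventually_mono[OF eventually_at_right_less])
  ultimately show ?thesis
    by (simp add: tendsto_lowerbound)
qed

definition comm :: "('a::real_normed_vector \<Rightarrow>\<^sub>L 'a) \<Rightarrow> ('a \<Rightarrow>\<^sub>L 'a) \<Rightarrow> ('a \<Rightarrow>\<^sub>L 'a)"
  where "comm A B = (A o\<^sub>L B) - (B o\<^sub>L A)"

lemma comm_apply: "comm A B v = A (B v) - B (A v)"
  by (simp add: comm_def blinfun.diff_left)

lemma comm_add_right: "comm A (B + C) = comm A B + comm A C"
  and comm_diff_right: "comm A (B - C) = comm A B - comm A C"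
  and comm_scaleR_right: "comm A (r *\<^sub>R B) = r *\<^sub>R comm A B"
  and comm_scaleR_left: "comm (r *\<^sub>R A) B = r *\<^sub>R comm A B"
  by (rule blinfun_eqI; simp add: comm_apply blinfun.bilinear_simps algebra_simps)+

lemma comm_sum_left: "comm (\<Sum>i\<in>I. A i) B = (\<Sum>i\<in>I. comm (A i) B)"
  and comm_sum_right: "comm B (\<Sum>i\<in>I. A i) = (\<Sum>i\<in>I. comm B (A i))"
  by (rule blinfun_eqI; simp add: comm_apply blinfun.bilinear_simps blinfun.sum_left blinfun.sum_right
      sum_subtractf)+

lemma norm_comm_le: "norm (comm A B) \<le> 2 * norm A * norm B"
proof -
  have "norm (comm A B) \<le> norm (A o\<^sub>L B) + norm (B o\<^sub>L A)"
    unfolding comm_def by (rule norm_triangle_ineq4)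
  also have "\<dots> \<le> norm A * norm B + norm B * norm A"
    by (intro add_mono norm_blinfun_compose)
  finally show ?thesis
    by simp
qed

text \<open>By polarization this is skew-symmetry for the real inner product; the norm computations
  need only the quadratic form.\<close>

definition skew :: "('a::real_inner \<Rightarrow>\<^sub>L 'a) \<Rightarrow> bool"
  where "skew S \<longleftrightarrow> (\<forall>v. v \<bullet> S v = 0)"

lemma skew_sum: "(\<And>i. i \<in> I \<Longrightarrow> skew (S i)) \<Longrightarrow> skew (\<Sum>i\<in>I. S i)"
  by (simp add: skew_def blinfun.sum_left inner_sum_right)

lemma skew_uminus: "skew S \<Longrightarrow> skew (- S)"
  by (simp add: skew_def blinfun.minus_left)

text \<open>Conjugation by the near-isometry \<open>1 + h S\<close> changes norms only to second order in \<open>h\<close>.\<close>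

lemma norm_add_comm_skew_le:
  assumes S: "skew S" and k: "norm S \<le> k"
  shows "norm (B + h *\<^sub>R comm S B) \<le> (1 + 2 * (h\<^sup>2 * k\<^sup>2)) * norm B"
proof -
  have k0: "0 \<le> k"
    using k norm_ge_zero order_trans by blast
  have iso: "norm (id_blinfun + r *\<^sub>R S) \<le> sqrt (1 + h\<^sup>2 * k\<^sup>2)" if r: "\<bar>r\<bar> = \<bar>h\<bar>" for r
  proof (rule norm_blinfun_bound)
    fix v
    \<comment> \<open>Skewness removes the cross term, so the deviation from an isometry is
      quadratic in \<open>r\<close>.\<close>
    have "(norm ((id_blinfun + r *\<^sub>R S) v))\<^sup>2 = (norm v)\<^sup>2 + r\<^sup>2 * (norm (S v))\<^sup>2"
      unfolding power2_norm_eq_inner using S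
      by (simp add: skew_def blinfun.bilinear_simps inner_simps inner_commute[of "S v" v] power2_eq_square)
    also have "\<dots> \<le> (norm v)\<^sup>2 + h\<^sup>2 * (k * norm v)\<^sup>2"
    proof -
      have "norm (S v) \<le> k * norm v"
        using norm_blinfun[of S v] k by (meson mult_right_mono norm_ge_zero order_trans)
      moreover have "r\<^sup>2 = h\<^sup>2"
        using r by (metis power2_abs)
      ultimately show ?thesis
        by (simp add: mult_left_mono power_mono)
    qed
    also have "\<dots> = (sqrt (1 + h\<^sup>2 * k\<^sup>2) * norm v)\<^sup>2"
      by (simp add: power_mult_distrib real_sqrt_pow2 algebra_simps)
    finally show "norm ((id_blinfun + r *\<^sub>R S) v) \<le> sqrt (1 + h\<^sup>2 * k\<^sup>2) * norm v"
      by (rule power2_le_imp_le) simp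
  qed simp
  \<comment> \<open>Expanding the conjugation by \<open>1 + h S\<close> gives the wanted first-order
    term and an excess of \<open>- h\<^sup>2\<close> times \<open>S B S\<close>, which is added
    back.\<close>
  have eq: "B + h *\<^sub>R comm S B =
      ((id_blinfun + h *\<^sub>R S) o\<^sub>L B o\<^sub>L (id_blinfun + (- h) *\<^sub>R S)) + h\<^sup>2 *\<^sub>R (S o\<^sub>L B o\<^sub>L S)"
    by (rule blinfun_eqI) (simp add: comm_apply blinfun.bilinear_simps algebra_simps power2_eq_square)
  have "norm ((id_blinfun + h *\<^sub>R S) o\<^sub>L B o\<^sub>L (id_blinfun + (- h) *\<^sub>R S))
      \<le> sqrt (1 + h\<^sup>2 * k\<^sup>2) * norm B * sqrt (1 + h\<^sup>2 * k\<^sup>2)"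
    by (rule order_trans[OF norm_blinfun_compose mult_mono] order_trans[OF norm_blinfun_compose]
        mult_mono iso mult_nonneg_nonneg norm_ge_zero real_sqrt_ge_zero order_refl | simp)+
  also have "\<dots> = (1 + h\<^sup>2 * k\<^sup>2) * norm B"
    by (simp add: mult.commute mult.left_commute real_sqrt_mult_self flip: mult.assoc)
  moreover have "norm (h\<^sup>2 *\<^sub>R (S o\<^sub>L B o\<^sub>L S)) \<le> h\<^sup>2 * (k\<^sup>2 * norm B)"
  proof -
    have "norm (S o\<^sub>L B o\<^sub>L S) \<le> (k * norm B) * k"
      using k k0
      by (intro order_trans[OF norm_blinfun_compose mult_mono] order_trans[OF norm_blinfun_compose]
          mult_mono mult_nonneg_nonneg) auto
    then have "h\<^sup>2 * norm (S o\<^sub>L B o\<^sub>L S) \<le> h\<^sup>2 * ((k * norm B) * k)"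
      by (rule mult_left_mono) simp
    then show ?thesis
      by (simp add: power2_eq_square ac_simps)
  qed
  ultimately show ?thesis
    unfolding eq by (smt (verit) distrib_right norm_triangle_ineq mult.assoc mult_1)
qed

definition centralizer :: "('a::real_normed_vector \<Rightarrow>\<^sub>L 'a) set \<Rightarrow> ('a \<Rightarrow>\<^sub>L 'a) set"
  where "centralizer C = {A. \<forall>B\<in>C. comm A B = 0}"

lemma comm_eq_0_iff: "comm A B = 0 \<longleftrightarrow> (\<forall>v. A (B v) = B (A v))"
  by (metis blinfun_eqI comm_apply right_minus_eq zero_blinfun.rep_eq)

lemma centralizer_scaleR: "A \<in> centralizer C \<Longrightarrow> r *\<^sub>R A \<in> centralizer C"
  by (simp add: centralizer_def comm_scaleR_left)

lemma centralizer_0: "0 \<in> centralizer C"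
  by (simp add: centralizer_def comm_eq_0_iff)

lemma centralizer_add: "A \<in> centralizer C \<Longrightarrow> B \<in> centralizer C \<Longrightarrow> A + B \<in> centralizer C"
  by (simp add: centralizer_def comm_eq_0_iff blinfun.bilinear_simps)

lemma centralizer_comm: "A \<in> centralizer C \<Longrightarrow> B \<in> centralizer C \<Longrightarrow> comm A B \<in> centralizer C"
  by (simp add: centralizer_def comm_eq_0_iff comm_apply blinfun.bilinear_simps)

text \<open>The quantity whose growth in time is tracked. Over a family of contractions the supremum
  is finite, since each commutator has norm at most \<open>2 * norm B\<close>.\<close>

definition comm_norm :: "('a::real_normed_vector \<Rightarrow>\<^sub>L 'a) set \<Rightarrow> ('a \<Rightarrow>\<^sub>L 'a) \<Rightarrow> real"
  where "comm_norm \<O> B = (SUP A\<in>\<O>. norm (comm A B))"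

lemma norm_comm_contraction_le: "norm A \<le> 1 \<Longrightarrow> norm (comm A B) \<le> 2 * norm B"
  using norm_comm_le[of A B] mult_right_mono[of "2 * norm A" 2 "norm B"] by simp

lemma comm_norm_upper:
  assumes "\<And>A. A \<in> \<O> \<Longrightarrow> norm A \<le> 1" "A \<in> \<O>"
  shows "norm (comm A B) \<le> comm_norm \<O> B"
  unfolding comm_norm_def using assms
  by (intro cSUP_upper bdd_aboveI2[where M = "2 * norm B"] norm_comm_contraction_le)

lemma comm_norm_least:
  assumes "\<O> \<noteq> {}" "\<And>A. A \<in> \<O> \<Longrightarrow> norm (comm A B) \<le> M"
  shows "comm_norm \<O> B \<le> M"
  unfolding comm_norm_def using assms by (rule cSUP_least)

text \<open>The commutator is linear in \<open>B\<close> with a bound uniform over the family; this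
  Lipschitz estimate is what lets continuity pass through the supremum.\<close>

lemma comm_norm_diff_le:
  assumes unit: "\<And>A. A \<in> \<O> \<Longrightarrow> norm A \<le> 1" and ne: "\<O> \<noteq> {}"
  shows "\<bar>comm_norm \<O> B - comm_norm \<O> C\<bar> \<le> 2 * norm (B - C)"
proof -
  have "comm_norm \<O> B \<le> comm_norm \<O> C + 2 * norm (B - C)" for B C
  proof (rule comm_norm_least[OF ne])
    fix A assume A: "A \<in> \<O>"
    have "comm A B = comm A C + comm A (B - C)"
      by (simp flip: comm_add_right)
    then have "norm (comm A B) \<le> norm (comm A C) + norm (comm A (B - C))"
      by (simp add: norm_triangle_ineq)
    also have "\<dots> \<le> comm_norm \<O> C + 2 * norm (B - C)"
      using A unit by (intro add_mono comm_norm_upper norm_comm_contraction_le) auto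
    finally show "norm (comm A B) \<le> comm_norm \<O> C + 2 * norm (B - C)" .
  qed
  from this[of B C] this[of C B] show ?thesis
    by (simp add: norm_minus_commute)
qed

lemma continuous_on_comm_norm:
  assumes unit: "\<And>A. A \<in> \<O> \<Longrightarrow> norm A \<le> 1" and ne: "\<O> \<noteq> {}"
    and B: "continuous_on I B"
  shows "continuous_on I (\<lambda>t. comm_norm \<O> (B t))"
proof -
  have "continuous_on UNIV (comm_norm \<O>)"
    unfolding continuous_on_iff dist_norm
  proof (intro ballI allI impI)
    fix B e :: real and C assume "0 < e"
    have "norm (comm_norm \<O> B' - comm_norm \<O> C) < e" if "norm (B' - C) < e / 2" for B'
      using comm_norm_diff_le[OF unit ne, of B' C] that by simp
    then show "\<exists>d>0. \<forall>B'\<in>UNIV. norm (B' - C) < d \<longrightarrow> norm (comm_norm \<O> B' - comm_norm \<O> C) < e"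
      using \<open>0 < e\<close> by (intro exI[of _ "e / 2"]) auto
  qed
  from continuous_on_compose2[OF this B] show ?thesis
    by simp
qed

text \<open>A Lieb-Robinson estimate. For an operator supported on \<open>X\<close>, the generators supported off
  \<open>X\<close> and the one supported on \<open>X\<close> itself only rotate the commutator, so that its growth is
  driven by the generators crossing the boundary of \<open>X\<close>.\<close>

lemma commutator_growth:
  fixes S :: "'i set \<Rightarrow> real \<Rightarrow> ('a::real_inner \<Rightarrow>\<^sub>L 'a)"
    and C :: "'i set \<Rightarrow> ('a \<Rightarrow>\<^sub>L 'a) set"
  assumes fin: "finite E" and EF: "E \<subseteq> F" and T: "0 \<le> T" and g: "0 < g"
    and off: "\<And>e X t. e \<in> E \<Longrightarrow> X \<in> F \<Longrightarrow> e \<inter> X = {} \<Longrightarrow> t \<in> {0..T} \<Longrightarrow> S e t \<in> C X"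
    and on: "\<And>e t. e \<in> E \<Longrightarrow> t \<in> {0..T} \<Longrightarrow> S e t \<in> centralizer (C e)"
    and skew: "\<And>e t. e \<in> E \<Longrightarrow> t \<in> {0..T} \<Longrightarrow> skew (S e t)"
    and bound: "\<And>e t. e \<in> E \<Longrightarrow> t \<in> {0..T} \<Longrightarrow> norm (S e t) \<le> g"
    and boundary: "\<And>X. X \<in> F \<Longrightarrow> card {e \<in> E. e \<inter> X \<noteq> {} \<and> e \<noteq> X} \<le> d"
    and deriv: "\<And>t. t \<in> {0..T} \<Longrightarrow>
      (B has_vector_derivative comm (\<Sum>e\<in>E. S e t) (B t)) (at t within {0..T})"
    and init: "\<And>X A. X \<in> F \<Longrightarrow> A \<in> centralizer (C X) \<Longrightarrow> norm A \<le> 1 \<Longrightarrow> norm (comm A (B 0)) \<le> M"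
    and X: "X \<in> F" and A: "A \<in> centralizer (C X)" "norm A \<le> 1"
  shows "norm (comm A (B T)) \<le> M * exp (2 * g * d * T)"
proof -
  \<comment> \<open>All supports in \<open>F\<close> enter one supremum. This closes the inequality:
    a generator crossing the boundary of \<open>X\<close> sits on an edge, which is again in
    \<open>F\<close>, so its commutator is bounded by the same quantity.\<close>
  define \<O> where "\<O> = {A. norm A \<le> 1 \<and> (\<exists>X\<in>F. A \<in> centralizer (C X))}"
  have unit: "\<And>A. A \<in> \<O> \<Longrightarrow> norm A \<le> 1"
    by (simp add: \<O>_def)
  have zero: "0 \<in> \<O>"
    using X by (auto simp: \<O>_def centralizer_0)
  then have ne: "\<O> \<noteq> {}"
    by blast
  have scaled: "norm (comm A B) \<le> r * comm_norm \<O> B"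
    if "X \<in> F" "A \<in> centralizer (C X)" "norm A \<le> r" "0 < r" for A X r B
  proof -
    have "(1 / r) *\<^sub>R A \<in> \<O>"
      using that centralizer_scaleR[OF that(2), of "1 / r"]
      by (auto simp: \<O>_def divide_simps intro!: bexI[of _ X])
    then have "norm (comm ((1 / r) *\<^sub>R A) B) \<le> comm_norm \<O> B"
      using unit by (rule comm_norm_upper[rotated])
    then show ?thesis
      using \<open>0 < r\<close> by (simp add: comm_scaleR_left field_simps)
  qed
  define f where "f = (\<lambda>s. comm_norm \<O> (B s))"
  have f0: "0 \<le> f s" for s
    unfolding f_def by (rule order_trans[OF norm_ge_zero comm_norm_upper[OF unit zero]])
  have cont: "continuous_on {0..T} f"
    unfolding f_def using unit ne
  proof (rule continuous_on_comm_norm)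
    show "continuous_on {0..T} B"
      unfolding continuous_on_eq_continuous_within
      using deriv has_vector_derivative_continuous by blast
  qed
  have "f T \<le> f 0 * exp ((2 * g * d) * T)"
  proof (rule dini_gronwall[OF cont T f0])
    show "0 \<le> 2 * g * d"
      using g by simp
    fix s \<epsilon> :: real
    assume s: "0 \<le> s" "s < T" and \<epsilon>: "0 < \<epsilon>"
    then have sT: "s \<in> {0..T}"
      by simp
    \<comment> \<open>A bound for every partial sum of generators; adding \<open>1\<close> keeps it
      positive even without edges.\<close>
    define k where "k = g * card E + 1"
    have k: "0 < k"
      using g by (simp add: k_def add_nonneg_pos)
    \<comment> \<open>Collects the coefficients of \<open>h\<^sup>2\<close>: the bracket bounds the
      excess of \<open>\<rho> * \<rho>\<close> over \<open>1\<close> when \<open>h < 1\<close>, and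
      the last term bounds the remainder \<open>R\<close>.\<close>
    define Q where "Q = (4 * k\<^sup>2 + 4 * (k\<^sup>2 * k\<^sup>2)) * f s + 8 * k\<^sup>2 * norm (B s)"
    have Q: "0 \<le> Q"
      using f0[of s] by (simp add: Q_def)
    define B' where "B' = comm (\<Sum>e\<in>E. S e s) (B s)"
    have "\<forall>e>0. \<exists>d>0. \<forall>y\<in>{0..T}. norm (y - s) < d \<longrightarrow>
        norm (B y - B s - (y - s) *\<^sub>R B') \<le> e * norm (y - s)"
      using deriv[OF sT] unfolding has_vector_derivative_def has_derivative_within_alt B'_def
      by blast
    then obtain \<delta> where \<delta>: "\<delta> > 0" and \<delta>B: "\<And>y. y \<in> {0..T} \<Longrightarrow> norm (y - s) < \<delta> \<Longrightarrow>
        norm (B y - B s - (y - s) *\<^sub>R B') \<le> (\<epsilon> / 4) * norm (y - s)"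
      using \<epsilon> by (meson divide_pos_pos zero_less_numeral)
    \<comment> \<open>The derivative is approximated with error \<open>\<epsilon> / 4\<close>, which
      a commutator with a contraction doubles; \<open>h * Q\<close> takes the other half of
      \<open>\<epsilon>\<close>. The bound \<open>1\<close> lets fourth powers of \<open>h\<close>
      be absorbed into squares.\<close>
    define d' where "d' = min \<delta> (min 1 (\<epsilon> / (2 * (Q + 1))))"
    have "d' > 0"
      using \<delta> \<epsilon> Q by (simp add: d'_def)
    moreover have "f (s + h) \<le> f s + h * (2 * g * d * f s + \<epsilon>)"
      if h: "0 < h" "h < d'" "s + h \<le> T" for h
    proof -
      have h1: "h < 1" and hQ: "h * Q \<le> \<epsilon> / 2"
      proof -
        show "h < 1"
          using h by (simp add: d'_def)
        have "h * (Q + 1) \<le> \<epsilon> / 2"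
          using h Q by (simp add: d'_def field_simps)
        then show "h * Q \<le> \<epsilon> / 2"
          using h by (simp add: algebra_simps)
      qed
      define \<rho> where "\<rho> = 1 + 2 * (h\<^sup>2 * k\<^sup>2)"
      have \<rho>: "0 < \<rho>"
        by (simp add: \<rho>_def add_pos_nonneg)
      have \<rho>2: "\<rho> * \<rho> \<le> 1 + h\<^sup>2 * (4 * k\<^sup>2 + 4 * (k\<^sup>2 * k\<^sup>2))"
      proof -
        have "h\<^sup>2 * h\<^sup>2 * (k\<^sup>2 * k\<^sup>2) \<le> h\<^sup>2 * 1 * (k\<^sup>2 * k\<^sup>2)"
          using h h1 by (intro mult_right_mono mult_left_mono) (auto simp: power_le_one)
        then show ?thesis
          by (simp add: \<rho>_def algebra_simps)
      qed
      have one: "norm (comm A (B (s + h))) \<le> f s + h * (2 * g * d * f s + \<epsilon>)"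
        if "X \<in> F" "A \<in> centralizer (C X)" "norm A \<le> 1" for A X
      proof -
        \<comment> \<open>The generator splits into the crossing part \<open>S1\<close>, the part
          \<open>K\<close> on \<open>X\<close> itself (zero if \<open>X\<close> is not an edge) and
          the part \<open>S3\<close> off \<open>X\<close>, which commutes with \<open>A\<close>.
          Only \<open>S1\<close> will contribute to the growth at first order.\<close>
        define N where "N = {e \<in> E. e \<inter> X \<noteq> {} \<and> e \<noteq> X}"
        define S1 where "S1 = (\<Sum>e\<in>N. S e s)"
        define S2 where "S2 = (\<Sum>e\<in>E - N. S e s)"
        define K where "K = (\<Sum>e\<in>E \<inter> {X}. S e s)"
        define S3 where "S3 = (\<Sum>e\<in>{e \<in> E. e \<inter> X = {} \<and> e \<noteq> X}. S e s)"
        have split: "(\<Sum>e\<in>E. S e s) = S1 + S2"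
          unfolding S1_def S2_def using fin by (subst sum.subset_diff[of N]) (auto simp: N_def)
        have "E - N = (E \<inter> {X}) \<union> {e \<in> E. e \<inter> X = {} \<and> e \<noteq> X}"
          by (auto simp: N_def)
        then have S2: "S2 = K + S3"
          unfolding S2_def K_def S3_def using fin by (auto intro!: sum.union_disjoint)
        have sumbound: "norm (\<Sum>e\<in>D. S e s) \<le> k" if "D \<subseteq> E" for D
        proof -
          have "norm (\<Sum>e\<in>D. S e s) \<le> card D * g"
            using bound[OF _ sT] that by (intro sum_norm_bound) auto
          also have "\<dots> \<le> card E * g"
            using that fin g by (intro mult_right_mono) (auto simp: card_mono)
          finally show ?thesis
            by (simp add: k_def mult.commute)
        qed
        have K: "K \<in> centralizer (C X)"
          unfolding K_def using on[OF _ sT] by (auto simp: Int_insert_right centralizer_0)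
        have S3: "comm A S3 = 0"
          using that(2) off[OF _ \<open>X \<in> F\<close> _ sT]
          by (auto simp: S3_def comm_sum_right centralizer_def intro!: sum.neutral)
        have skew_K: "skew K" and skew_S2: "skew S2"
          unfolding K_def S2_def using skew sT by (auto intro!: skew_sum)
        have norm_K: "norm K \<le> k" and norm_S2: "norm S2 \<le> k"
          unfolding K_def S2_def by (auto intro!: sumbound)
        \<comment> \<open>Instead of estimating the commutator of \<open>A\<close> with
          \<open>K\<close>, \<open>A\<close> is rotated by it: the result is still supported on
          \<open>X\<close>, and its norm grows only at second order.\<close>
        define A1 where "A1 = A + (- h) *\<^sub>R comm K A"
        have A1: "A1 \<in> centralizer (C X)"
          unfolding A1_def using K that by (intro centralizer_add centralizer_scaleR centralizer_comm)
        have "norm A1 \<le> (1 + 2 * ((- h)\<^sup>2 * k\<^sup>2)) * norm A"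
          unfolding A1_def by (rule norm_add_comm_skew_le[OF skew_K norm_K])
        also have "\<dots> \<le> \<rho> * 1"
          using that \<rho> unfolding \<rho>_def power2_minus by (intro mult_left_mono) auto
        finally have nA1: "norm A1 \<le> \<rho>"
          by simp
        define C1 where "C1 = comm A1 (B s)"
        have C1: "norm C1 \<le> \<rho> * f s"
          unfolding C1_def f_def using A1 nA1 \<rho> \<open>X \<in> F\<close> by (intro scaled)
        define R where "R = comm S2 (comm (comm A K) (B s))"
        have R: "norm R \<le> 8 * k\<^sup>2 * norm (B s)"
        proof -
          have "norm (comm A K) \<le> 2 * k"
            using norm_comm_contraction_le[OF that(3), of K] norm_K by simp
          then have "norm (comm (comm A K) (B s)) \<le> 2 * (2 * k) * norm (B s)"
            using norm_comm_le[of "comm A K" "B s"] mult_right_mono[of _ _ "norm (B s)"]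
            by (smt (verit, ccfv_SIG) norm_ge_zero)
          moreover have "norm R \<le> 2 * k * norm (comm (comm A K) (B s))"
            using norm_S2 unfolding R_def
            by (intro order_trans[OF norm_comm_le] mult_right_mono mult_left_mono) auto
          ultimately have "norm R \<le> 2 * k * (2 * (2 * k) * norm (B s))"
            using k by (elim order_trans[rotated, OF mult_left_mono]) auto
          then show ?thesis
            by (simp add: power2_eq_square)
        qed
        have AS2: "comm A S2 = comm A K"
          by (simp add: S2 comm_add_right S3)
        \<comment> \<open>The Jacobi identity together with \<open>AS2\<close>: evolving
          \<open>B\<close> by \<open>S2\<close> amounts to rotating \<open>A\<close> into
          \<open>A1\<close> and then rotating the resulting commutator by \<open>S2\<close>, with an
          error of order \<open>h\<^sup>2\<close>.\<close>
        have rot: "comm A (B s + h *\<^sub>R comm S2 (B s)) = C1 + h *\<^sub>R comm S2 C1 - h\<^sup>2 *\<^sub>R R"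
        proof (rule blinfun_eqI)
          fix v
          have swap: "A (S2 w) = S2 (A w) + (A (K w) - K (A w))" for w
            using arg_cong[OF AS2, of "\<lambda>Z. Z w"] by (simp add: comm_apply algebra_simps)
          show "comm A (B s + h *\<^sub>R comm S2 (B s)) v = (C1 + h *\<^sub>R comm S2 C1 - h\<^sup>2 *\<^sub>R R) v"
            by (simp add: C1_def A1_def R_def comm_apply blinfun.bilinear_simps swap
                power2_eq_square algebra_simps)
        qed
        have part1: "norm (comm A (B s + h *\<^sub>R comm S2 (B s)))
            \<le> \<rho> * (\<rho> * f s) + h\<^sup>2 * (8 * k\<^sup>2 * norm (B s))"
        proof -
          have "norm (C1 + h *\<^sub>R comm S2 C1) \<le> \<rho> * norm C1"
            unfolding \<rho>_def by (rule norm_add_comm_skew_le[OF skew_S2 norm_S2])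
          also have "\<dots> \<le> \<rho> * (\<rho> * f s)"
            using C1 \<rho> by (intro mult_left_mono) auto
          finally have "norm (C1 + h *\<^sub>R comm S2 C1) \<le> \<rho> * (\<rho> * f s)" .
          moreover have "norm (h\<^sup>2 *\<^sub>R R) \<le> h\<^sup>2 * (8 * k\<^sup>2 * norm (B s))"
            using R by (simp add: mult_left_mono)
          ultimately show ?thesis
            unfolding rot by (intro order_trans[OF norm_triangle_ineq4] add_mono)
        qed
        \<comment> \<open>Each of at most \<open>d\<close> crossing generators has norm at most
          \<open>g\<close>, hence a commutator with \<open>B s\<close> of at most
          \<open>g * f s\<close>; the outer commutator with \<open>A\<close> costs the factor
          \<open>2\<close>.\<close>
        have part2: "norm (comm A (h *\<^sub>R comm S1 (B s))) \<le> h * (2 * g * d * f s)"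
        proof -
          have "norm (comm S1 (B s)) \<le> (\<Sum>e\<in>N. norm (comm (S e s) (B s)))"
            unfolding S1_def comm_sum_left by (rule norm_sum)
          also have "\<dots> \<le> card N * (g * f s)"
            unfolding f_def using EF g on[OF _ sT] bound[OF _ sT]
            by (intro sum_bounded_above scaled) (auto simp: N_def)
          also have "\<dots> \<le> d * (g * f s)"
            using boundary[OF \<open>X \<in> F\<close>] g f0[of s] by (intro mult_right_mono) (auto simp: N_def)
          finally have "norm (comm A (comm S1 (B s))) \<le> 2 * (d * (g * f s))"
            using norm_comm_contraction_le[OF that(3), of "comm S1 (B s)"] by simp
          then show ?thesis
            using h by (simp add: comm_scaleR_right mult_left_mono ac_simps)
        qed
        have part3: "norm (comm A (B (s + h) - B s - h *\<^sub>R B')) \<le> h * (\<epsilon> / 2)"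
          using norm_comm_contraction_le[OF that(3), of "B (s + h) - B s - h *\<^sub>R B'"]
            \<delta>B[of "s + h"] h s by (simp add: d'_def mult.commute[of h])
        have "comm A (B (s + h)) = comm A (B s + h *\<^sub>R comm S2 (B s))
            + comm A (h *\<^sub>R comm S1 (B s)) + comm A (B (s + h) - B s - h *\<^sub>R B')"
          unfolding B'_def split
          by (rule blinfun_eqI) (simp add: comm_apply blinfun.bilinear_simps algebra_simps)
        then have "norm (comm A (B (s + h))) \<le> \<rho> * (\<rho> * f s) + h\<^sup>2 * (8 * k\<^sup>2 * norm (B s))
            + h * (2 * g * d * f s) + h * (\<epsilon> / 2)"
          using part1 part2 part3
          by (auto intro!: order_trans[OF norm_triangle_ineq] add_mono)
        also have "\<dots> \<le> f s + h * (h * Q) + h * (2 * g * d * f s) + h * (\<epsilon> / 2)"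
          using mult_right_mono[OF \<rho>2 f0[of s]] by (simp add: Q_def algebra_simps power2_eq_square)
        also have "\<dots> \<le> f s + h * (\<epsilon> / 2) + h * (2 * g * d * f s) + h * (\<epsilon> / 2)"
          using mult_left_mono[OF hQ less_imp_le[OF h(1)]] by linarith
        also have "\<dots> = f s + h * (2 * g * d * f s + \<epsilon>)"
          by (simp add: algebra_simps)
        finally show ?thesis .
      qed
      then show ?thesis
        unfolding f_def[THEN fun_cong, of "s + h"] by (intro comm_norm_least[OF ne]) (auto simp: \<O>_def)
    qed
    ultimately show "\<exists>d'>0. \<forall>h. 0 < h \<and> h < d' \<and> s + h \<le> T \<longrightarrow>
        f (s + h) \<le> f s + h * (2 * g * d * f s + \<epsilon>)"
      by blast
  qed
  moreover have "f 0 \<le> M"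
    unfolding f_def using init by (intro comm_norm_least[OF ne]) (auto simp: \<O>_def)
  ultimately have "f T \<le> M * exp (2 * g * d * T)"
    by (meson exp_ge_zero mult_right_mono order_trans)
  moreover have "norm (comm A (B T)) \<le> f T"
    unfolding f_def using unit X A by (intro comm_norm_upper) (auto simp: \<O>_def)
  ultimately show ?thesis
    by simp
qed

section \<open>Orthogonal projections\<close>

definition orth_proj :: "('a::real_inner \<Rightarrow>\<^sub>L 'a) \<Rightarrow> bool"
  where "orth_proj P \<longleftrightarrow> (\<forall>v w. P v \<bullet> w = v \<bullet> P w) \<and> (\<forall>v. P (P v) = P v)"

lemma orth_projD:
  assumes "orth_proj P"
  shows "P v \<bullet> w = v \<bullet> P w" "P (P v) = P v"
  using assms by (auto simp: orth_proj_def)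

lemma orth_proj_compose:
  assumes "orth_proj P" "orth_proj Q" "comm P Q = 0"
  shows "orth_proj (P o\<^sub>L Q)"
  using assms by (auto simp: orth_proj_def comm_eq_0_iff)

lemma norm_orth_proj_apply_le:
  assumes P: "orth_proj P"
  shows "norm (P v) \<le> norm v"
proof -
  have "norm (P v) * norm (P v) = v \<bullet> P v"
    using orth_projD[OF P] by (simp flip: power2_eq_square add: power2_norm_eq_inner)
  also have "\<dots> \<le> norm v * norm (P v)"
    by (rule norm_cauchy_schwarz)
  finally show ?thesis
    by (metis mult_right_le_imp_le norm_ge_zero order_le_less)
qed

text \<open>\<open>2 P - 1\<close> is a reflection, hence an isometry. It supplies the single-site
  contraction whose commutator with the observable controls the variance.\<close>

lemma norm_reflection_le:
  assumes P: "orth_proj P"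
  shows "norm (2 *\<^sub>R P - id_blinfun) \<le> 1"
proof (rule norm_blinfun_bound)
  fix v
  have "(norm ((2 *\<^sub>R P - id_blinfun) v))\<^sup>2 = (norm v)\<^sup>2"
    unfolding power2_norm_eq_inner using orth_projD[OF P]
    by (simp add: blinfun.bilinear_simps inner_simps algebra_simps)
  then show "norm ((2 *\<^sub>R P - id_blinfun) v) \<le> 1 * norm v"
    by simp
qed simp

fun proj_prod :: "(nat \<Rightarrow> ('a::real_normed_vector \<Rightarrow>\<^sub>L 'a)) \<Rightarrow> nat \<Rightarrow> ('a \<Rightarrow>\<^sub>L 'a)" where
  "proj_prod p 0 = id_blinfun"
| "proj_prod p (Suc k) = proj_prod p k o\<^sub>L p k"

lemma comm_proj_prod:
  assumes "\<And>i. i < k \<Longrightarrow> comm (p i) Q = 0"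
  shows "comm (proj_prod p k) Q = 0"
  using assms by (induction k) (auto simp: comm_eq_0_iff)

lemma orth_proj_proj_prod:
  assumes "\<And>i. i < k \<Longrightarrow> orth_proj (p i)"
    and "\<And>i j. i < j \<Longrightarrow> j < k \<Longrightarrow> comm (p i) (p j) = 0"
  shows "orth_proj (proj_prod p k)"
  using assms
proof (induction k)
  case 0
  then show ?case
    by (simp add: orth_proj_def)
next
  case (Suc k)
  then show ?case
    by (auto intro!: orth_proj_compose comm_proj_prod)
qed

text \<open>The increments of \<open>v - p\<^sub>0 \<dots> p\<^sub>k v\<close> are orthogonal.\<close>

lemma efron_stein:
  assumes "\<And>i. i < k \<Longrightarrow> orth_proj (p i)"
    and "\<And>i j. i < j \<Longrightarrow> j < k \<Longrightarrow> comm (p i) (p j) = 0"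
  shows "(norm (v - proj_prod p k v))\<^sup>2 \<le> (\<Sum>i<k. (norm (v - p i v))\<^sup>2)"
  using assms
proof (induction k)
  case 0
  then show ?case
    by simp
next
  case (Suc k)
  define P where "P = proj_prod p k"
  have P: "orth_proj P"
    unfolding P_def using Suc.prems by (intro orth_proj_proj_prod) auto
  define w where "w = v - p k v"
  \<comment> \<open>Telescoping: the new increment lies in the range of \<open>P\<close>, while
    \<open>v - P v\<close> is orthogonal to that range.\<close>
  have eq: "v - proj_prod p (Suc k) v = (v - P v) + P w"
    by (simp add: P_def w_def blinfun.diff_right)
  have "(v - P v) \<bullet> P w = 0"
    using orth_projD(2)[OF P] by (simp add: blinfun.diff_right flip: orth_projD(1)[OF P])
  then have "(norm (v - proj_prod p (Suc k) v))\<^sup>2 = (norm (v - P v))\<^sup>2 + (norm (P w))\<^sup>2"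
    unfolding eq power2_norm_eq_inner by (simp add: inner_add inner_commute)
  also have "\<dots> \<le> (\<Sum>i<k. (norm (v - p i v))\<^sup>2) + (norm w)\<^sup>2"
    using Suc norm_orth_proj_apply_le[OF P, of w]
    by (intro add_mono power_mono) (auto simp: P_def)
  finally show ?case
    by (simp add: w_def)
qed

section \<open>Matrices as bounded operators\<close>

lemma finite_basis: "finite (basis n)"
  by (simp add: basis_def)

lemma norm_lookup_le: "norm (poly_mapping.lookup v x) \<le> norm (v :: 'a \<Rightarrow>\<^sub>0 'b::real_inner)"
proof (cases "x \<in> Poly_Mapping.keys v")
  case True
  have "(norm (poly_mapping.lookup v x))\<^sup>2 \<le> (norm v)\<^sup>2"
    unfolding power2_norm_eq_inner inner_poly_mapping_def[of v v] using True
    by (intro member_le_sum) auto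
  then show ?thesis
    by (rule power2_le_imp_le) simp
qed (simp add: in_keys_iff)

lemma bounded_linear_lookup:
  "bounded_linear (\<lambda>v :: 'a \<Rightarrow>\<^sub>0 'b::real_inner. poly_mapping.lookup v x)"
  by (rule bounded_linear_intro[where K = 1]) (simp_all add: lookup_add lookup_scaleR norm_lookup_le)

lemma bounded_linear_single: "bounded_linear (Poly_Mapping.single x :: 'b::real_inner \<Rightarrow> 'a \<Rightarrow>\<^sub>0 'b)"
proof (rule bounded_linear_intro[where K = 1])
  fix r :: real and b :: 'b
  show "Poly_Mapping.single x (r *\<^sub>R b) = r *\<^sub>R Poly_Mapping.single x b"
    by (rule poly_mapping_eqI) (simp add: lookup_scaleR lookup_single when_def)
  show "norm (Poly_Mapping.single x b) \<le> norm b * 1"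
    by (simp add: norm_poly_mapping_def inner_poly_mapping_superset[of "{x}"] norm_eq_sqrt_inner)
qed (simp add: single_add)

text \<open>Labels outside \<open>basis n\<close> are sent to \<open>0\<close>, so the identity
  matrix becomes the projection onto the register and not \<open>id_blinfun\<close>.\<close>

definition mat_op :: "nat \<Rightarrow> (nat set \<Rightarrow> nat set \<Rightarrow> complex) \<Rightarrow>
    ((nat set \<Rightarrow>\<^sub>0 complex) \<Rightarrow>\<^sub>L (nat set \<Rightarrow>\<^sub>0 complex))"
  where "mat_op n M = Blinfun (\<lambda>v. \<Sum>x\<in>basis n. \<Sum>y\<in>basis n.
    Poly_Mapping.single x (M x y * poly_mapping.lookup v y))"

lemma lookup_mat_op:
  "poly_mapping.lookup (mat_op n M v) x =
    (if x \<in> basis n then mat_vec n M (poly_mapping.lookup v) x else 0)"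
proof -
  have "bounded_linear (\<lambda>v. \<Sum>x\<in>basis n. \<Sum>y\<in>basis n.
      Poly_Mapping.single x (M x y * poly_mapping.lookup v y))"
    by (intro bounded_linear_sum bounded_linear_compose[OF bounded_linear_single]
        bounded_linear_compose[OF bounded_linear_mult_right] bounded_linear_lookup)
  then have "mat_op n M v = (\<Sum>x\<in>basis n. \<Sum>y\<in>basis n.
      Poly_Mapping.single x (M x y * poly_mapping.lookup v y))"
    unfolding mat_op_def by (simp add: bounded_linear_Blinfun_apply)
  then have "poly_mapping.lookup (mat_op n M v) x
      = (\<Sum>x'\<in>basis n. \<Sum>y\<in>basis n. if x' = x then M x' y * poly_mapping.lookup v y else 0)"
    by (simp add: lookup_sum lookup_single when_def)
  also have "\<dots> = (\<Sum>x'\<in>basis n. if x' = x then mat_vec n M (poly_mapping.lookup v) x else 0)"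
    by (intro sum.cong) (auto simp: mat_vec_def)
  finally show ?thesis
    by (simp add: finite_basis)
qed

lemma mat_op_eqI:
  fixes A :: "(nat set \<Rightarrow>\<^sub>0 complex) \<Rightarrow>\<^sub>L (nat set \<Rightarrow>\<^sub>0 complex)"
  assumes "\<And>v x. x \<in> basis n \<Longrightarrow> poly_mapping.lookup (A v) x = mat_vec n M (poly_mapping.lookup v) x"
    and "\<And>v x. x \<notin> basis n \<Longrightarrow> poly_mapping.lookup (A v) x = 0"
  shows "A = mat_op n M"
  using assms by (intro blinfun_eqI poly_mapping_eqI) (auto simp: lookup_mat_op)

lemma mat_op_cong:
  "(\<And>x y. x \<in> basis n \<Longrightarrow> y \<in> basis n \<Longrightarrow> A x y = B x y) \<Longrightarrow> mat_op n A = mat_op n B"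
  by (rule mat_op_eqI) (auto simp: lookup_mat_op mat_vec_def intro!: sum.cong)

lemma mat_op_compose: "mat_op n A o\<^sub>L mat_op n B = mat_op n (mat_mul n A B)"
proof (rule mat_op_eqI)
  fix v x assume "x \<in> basis n"
  then show "poly_mapping.lookup ((mat_op n A o\<^sub>L mat_op n B) v) x
      = mat_vec n (mat_mul n A B) (poly_mapping.lookup v) x"
    by (simp add: lookup_mat_op mat_vec_def mat_mul_def sum_distrib_left sum_distrib_right mult.assoc)
      (rule sum.swap)
qed (simp add: lookup_mat_op)

lemma mat_op_sum: "mat_op n (\<lambda>x y. \<Sum>i\<in>I. M i x y) = (\<Sum>i\<in>I. mat_op n (M i))"
proof (rule mat_op_eqI[symmetric])
  fix v x assume "x \<in> basis n"
  then show "poly_mapping.lookup ((\<Sum>i\<in>I. mat_op n (M i)) v) x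
      = mat_vec n (\<lambda>x y. \<Sum>i\<in>I. M i x y) (poly_mapping.lookup v) x"
    by (simp add: blinfun.sum_left lookup_sum lookup_mat_op mat_vec_def sum_distrib_right)
      (rule sum.swap)
qed (simp add: blinfun.sum_left lookup_sum lookup_mat_op)

lemma mat_op_uminus: "mat_op n (\<lambda>x y. - M x y) = - mat_op n M"
  by (rule mat_op_eqI[symmetric])
    (auto simp: blinfun.minus_left lookup_mat_op mat_vec_def sum_negf)

lemma keys_mat_op: "Poly_Mapping.keys (mat_op n M v) \<subseteq> basis n"
  by (auto simp: in_keys_iff lookup_mat_op split: if_splits)

lemma mat_op_id_apply:
  assumes "Poly_Mapping.keys v \<subseteq> basis n"
  shows "mat_op n id_mat v = v"
proof (rule poly_mapping_eqI)
  fix x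
  show "poly_mapping.lookup (mat_op n id_mat v) x = poly_mapping.lookup v x"
    using assms by (auto simp: lookup_mat_op mat_vec_def id_mat_def finite_basis in_keys_iff
        if_distrib[of "\<lambda>z. z * _"] cong: if_cong)
qed

lemma mat_op_id_left: "mat_op n id_mat o\<^sub>L mat_op n M = mat_op n M"
  by (rule blinfun_eqI) (simp add: mat_op_id_apply keys_mat_op)

lemma mat_op_id_right: "mat_op n M o\<^sub>L mat_op n id_mat = mat_op n M"
  unfolding mat_op_compose by (rule mat_op_cong)
    (auto simp: mat_mul_def id_mat_def finite_basis if_distrib[of "\<lambda>z. _ * z"] cong: if_cong)

text \<open>Entrywise differentiability passes to the operator because the operator is a finite real
  combination of fixed ones. Since bounded maps form only a real vector space here, each matrix unit
  occurs twice, with entry \<open>1\<close> and with entry \<open>\<i>\<close>.\<close>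

lemma mat_op_has_vector_derivative:
  assumes "\<And>x y. x \<in> basis n \<Longrightarrow> y \<in> basis n \<Longrightarrow>
    ((\<lambda>t. M t x y) has_vector_derivative D x y) F"
  shows "((\<lambda>t. mat_op n (M t)) has_vector_derivative mat_op n D) F"
proof -
  define unit :: "complex \<Rightarrow> nat set \<Rightarrow> nat set \<Rightarrow> nat set \<Rightarrow> nat set \<Rightarrow> complex"
    where "unit = (\<lambda>c x y x' y'. if x' = x \<and> y' = y then c else 0)"
  define R J where "R = (\<lambda>x y. mat_op n (unit 1 x y))" and "J = (\<lambda>x y. mat_op n (unit \<i> x y))"
  have decomp: "mat_op n N = (\<Sum>x\<in>basis n. \<Sum>y\<in>basis n.
      Re (N x y) *\<^sub>R R x y + Im (N x y) *\<^sub>R J x y)" for N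
  proof -
    have split: "mat_op n N = (\<Sum>x\<in>basis n. \<Sum>y\<in>basis n. mat_op n (unit (N x y) x y))"
    proof -
      have "mat_op n N = mat_op n (\<lambda>x' y'. \<Sum>x\<in>basis n. \<Sum>y\<in>basis n. unit (N x y) x y x' y')"
      proof (rule mat_op_cong)
        fix x' y' assume *: "x' \<in> basis n" "y' \<in> basis n"
        have "(\<Sum>x\<in>basis n. \<Sum>y\<in>basis n. unit (N x y) x y x' y')
            = (\<Sum>x\<in>basis n. if x = x' then N x y' else 0)"
          using * by (intro sum.cong) (auto simp: unit_def finite_basis sum.delta')
        then show "N x' y' = (\<Sum>x\<in>basis n. \<Sum>y\<in>basis n. unit (N x y) x y x' y')"
          using * by (simp add: finite_basis)
      qed
      then show ?thesis
        by (simp add: mat_op_sum)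
    qed
    have unit: "mat_op n (unit c x y)
        = Re c *\<^sub>R mat_op n (unit 1 x y) + Im c *\<^sub>R mat_op n (unit \<i> x y)" for c x y
    proof (rule mat_op_eqI[symmetric])
      fix v x' assume "x' \<in> basis n"
      have c: "unit c x y x' z * w = Re c *\<^sub>R (unit 1 x y x' z * w) + Im c *\<^sub>R (unit \<i> x y x' z * w)" for z w
        by (simp add: unit_def complex_eq_iff)
      show "poly_mapping.lookup ((Re c *\<^sub>R mat_op n (unit 1 x y) + Im c *\<^sub>R mat_op n (unit \<i> x y)) v) x'
          = mat_vec n (unit c x y) (poly_mapping.lookup v) x'"
        using \<open>x' \<in> basis n\<close>
        by (simp only: blinfun.add_left blinfun.scaleR_left lookup_add lookup_scaleR lookup_mat_op
            mat_vec_def c[of _ "poly_mapping.lookup v _"] scaleR_sum_right sum.distrib if_True)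
    qed (simp add: blinfun.bilinear_simps lookup_add lookup_scaleR lookup_mat_op)
    show ?thesis
      unfolding split R_def J_def by (intro sum.cong refl unit)
  qed
  show ?thesis
    unfolding decomp
  proof (intro has_vector_derivative_sum has_vector_derivative_add)
    fix x y assume xy: "x \<in> basis n" "y \<in> basis n"
    show "((\<lambda>t. Re (M t x y) *\<^sub>R A) has_vector_derivative Re (D x y) *\<^sub>R A) F"
      and "((\<lambda>t. Im (M t x y) *\<^sub>R A) has_vector_derivative Im (D x y) *\<^sub>R A) F"
      for A :: "(nat set \<Rightarrow>\<^sub>0 complex) \<Rightarrow>\<^sub>L (nat set \<Rightarrow>\<^sub>0 complex)"
      using assms[OF xy]
      by (intro bounded_linear.has_vector_derivative[OF bounded_linear_scaleR_left]
          bounded_linear.has_vector_derivative[OF bounded_linear_Re]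
          bounded_linear.has_vector_derivative[OF bounded_linear_Im]; simp)+
  qed
qed

lemma norm_poly_mapping_square:
  assumes "Poly_Mapping.keys v \<subseteq> basis n"
  shows "(norm (v :: nat set \<Rightarrow>\<^sub>0 complex))\<^sup>2 = (\<Sum>x\<in>basis n. (cmod (poly_mapping.lookup v x))\<^sup>2)"
  unfolding power2_norm_eq_inner inner_poly_mapping_superset[OF finite_basis assms] ..

lemma vnorm_lookup_le: "vnorm n (poly_mapping.lookup v) \<le> norm v"
proof -
  have "(vnorm n (poly_mapping.lookup v))\<^sup>2 = (\<Sum>x\<in>basis n. poly_mapping.lookup v x \<bullet> poly_mapping.lookup v x)"
    by (simp add: vnorm_def real_sqrt_pow2 sum_nonneg power2_norm_eq_inner)
  also have "\<dots> \<le> (\<Sum>x\<in>basis n \<union> Poly_Mapping.keys v. poly_mapping.lookup v x \<bullet> poly_mapping.lookup v x)"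
    by (rule sum_mono2) (auto simp: finite_basis)
  also have "\<dots> = (norm v)\<^sup>2"
    unfolding power2_norm_eq_inner
    by (rule inner_poly_mapping_superset[symmetric]) (auto simp: finite_basis)
  finally show ?thesis
    by (rule power2_le_imp_le) simp
qed

text \<open>\<open>opnorm\<close> is a bare supremum, which bounds its members only if they are
  bounded above. A crude entrywise estimate supplies this, and scaling to norm \<open>1\<close> does
  the rest.\<close>

lemma vnorm_mat_vec_le_opnorm: "vnorm n (mat_vec n M v) \<le> opnorm n M * vnorm n v"
proof (cases "vnorm n v = 0")
  case True
  then have "\<forall>x\<in>basis n. v x = 0"
    by (simp add: vnorm_def sum_nonneg_eq_0_iff finite_basis)
  then have "vnorm n (mat_vec n M v) = 0"
    by (simp add: vnorm_def mat_vec_def)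
  then show ?thesis
    using True by simp
next
  case False
  define c where "c = vnorm n v"
  have c: "0 < c"
    using False by (simp add: c_def vnorm_def sum_nonneg order_less_le)
  have hom: "vnorm n (\<lambda>x. w x / complex_of_real c) = vnorm n w / c" for w
    using c by (simp add: vnorm_def norm_divide power_divide real_sqrt_divide flip: sum_divide_distrib)
  have unit: "vnorm n (\<lambda>x. v x / complex_of_real c) = 1"
    using c unfolding hom by (simp add: c_def)
  have "bdd_above {vnorm n (mat_vec n M v) |v. vnorm n v = 1}"
  proof (rule bdd_aboveI)
    fix r assume "r \<in> {vnorm n (mat_vec n M v) |v. vnorm n v = 1}"
    then obtain w where r: "r = vnorm n (mat_vec n M w)" and w: "vnorm n w = 1"
      by auto
    have w1: "cmod (w y) \<le> 1" if "y \<in> basis n" for y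
    proof -
      have "(cmod (w y))\<^sup>2 \<le> (\<Sum>x\<in>basis n. (cmod (w x))\<^sup>2)"
        using that by (intro member_le_sum) (auto simp: finite_basis)
      also have "\<dots> = 1"
        using w by (simp add: vnorm_def)
      finally show ?thesis
        by (simp add: power_le_one_iff abs_square_le_1)
    qed
    have "cmod (mat_vec n M w x) \<le> (\<Sum>y\<in>basis n. cmod (M x y))" for x
      unfolding mat_vec_def using w1
      by (intro order_trans[OF norm_sum] sum_mono) (auto simp: norm_mult intro: mult_right_le_one_le)
    then show "r \<le> sqrt (\<Sum>x\<in>basis n. (\<Sum>y\<in>basis n. cmod (M x y))\<^sup>2)"
      unfolding r vnorm_def by (intro real_sqrt_le_mono sum_mono power_mono) auto
  qed
  then have "vnorm n (mat_vec n M (\<lambda>x. v x / complex_of_real c)) \<le> opnorm n M"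
    unfolding opnorm_def using unit by (intro cSup_upper) blast+
  moreover have "mat_vec n M (\<lambda>x. v x / complex_of_real c) = (\<lambda>x. mat_vec n M v x / complex_of_real c)"
    by (simp add: mat_vec_def sum_divide_distrib)
  ultimately show ?thesis
    using c by (simp add: hom field_simps flip: c_def)
qed

text \<open>Transfers the spectral norm bound on an interaction term to its operator. The unimodular
  \<open>c\<close> accommodates the factor \<open>- \<i>\<close> of the generator.\<close>

lemma norm_mat_op_le:
  assumes "opnorm n M \<le> g" "0 \<le> g" "cmod c = 1"
  shows "norm (mat_op n (\<lambda>x y. c * M x y)) \<le> g"
proof (rule norm_blinfun_bound)
  fix v
  have "(norm (mat_op n (\<lambda>x y. c * M x y) v))\<^sup>2 = (vnorm n (mat_vec n M (poly_mapping.lookup v)))\<^sup>2"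
    using assms(3) unfolding norm_poly_mapping_square[OF keys_mat_op]
    by (simp add: lookup_mat_op vnorm_def sum_nonneg mat_vec_def mult.assoc norm_mult
        flip: sum_distrib_left)
  then have "norm (mat_op n (\<lambda>x y. c * M x y) v) = vnorm n (mat_vec n M (poly_mapping.lookup v))"
    by (rule power2_eq_imp_eq) (simp_all add: vnorm_def sum_nonneg)
  also have "\<dots> \<le> opnorm n M * vnorm n (poly_mapping.lookup v)"
    by (rule vnorm_mat_vec_le_opnorm)
  also have "\<dots> \<le> g * norm v"
    using assms vnorm_lookup_le by (intro mult_mono) (auto simp: vnorm_def sum_nonneg)
  finally show "norm (mat_op n (\<lambda>x y. c * M x y) v) \<le> g * norm v" .
qed fact

lemma inner_mat_op:
  "mat_op n M v \<bullet> w = Re (\<Sum>x\<in>basis n. \<Sum>y\<in>basis n.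
    cnj (poly_mapping.lookup w x) * M x y * poly_mapping.lookup v y)"
proof -
  have inner: "a \<bullet> b = Re (cnj b * a)" for a b :: complex
    by (simp add: inner_complex_def)
  have "mat_op n M v \<bullet> w
      = (\<Sum>x\<in>basis n. Re (cnj (poly_mapping.lookup w x) * mat_vec n M (poly_mapping.lookup v) x))"
    unfolding inner_poly_mapping_superset[OF finite_basis keys_mat_op] inner
    by (simp add: lookup_mat_op)
  then show ?thesis
    by (simp only: Re_sum mat_vec_def sum_distrib_left mult.assoc)
qed

lemma hermitian_form_cnj:
  assumes "hermitian n M"
  shows "cnj (\<Sum>x\<in>basis n. \<Sum>y\<in>basis n. cnj (w x) * M x y * v y)
    = (\<Sum>x\<in>basis n. \<Sum>y\<in>basis n. cnj (v x) * M x y * w y)"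
proof -
  have "cnj (cnj (w x) * M x y * v y) = cnj (v y) * M y x * w x" if "x \<in> basis n" "y \<in> basis n" for x y
  proof -
    have "M y x = cnj (M x y)"
      using assms that unfolding hermitian_def by blast
    then show ?thesis
      by simp
  qed
  then show ?thesis
    unfolding cnj_sum by (subst sum.swap) (intro sum.cong refl)
qed

lemma inner_mat_op_hermitian:
  assumes "hermitian n M"
  shows "mat_op n M v \<bullet> w = v \<bullet> mat_op n M w"
proof -
  have "mat_op n M v \<bullet> w = Re (cnj (\<Sum>x\<in>basis n. \<Sum>y\<in>basis n.
      cnj (poly_mapping.lookup w x) * M x y * poly_mapping.lookup v y))"
    by (simp only: inner_mat_op cnj.sel(1))
  also have "\<dots> = mat_op n M w \<bullet> v"
    by (simp only: inner_mat_op hermitian_form_cnj[OF assms])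
  finally show ?thesis
    by (simp add: inner_commute)
qed

text \<open>The quadratic form of a Hermitian matrix is real, so the factor \<open>- \<i>\<close>
  makes it purely imaginary, and the real inner product sees only the real part.\<close>

lemma skew_mat_op:
  assumes "hermitian n M"
  shows "skew (mat_op n (\<lambda>x y. - \<i> * M x y))"
  unfolding skew_def
proof
  fix v
  define q where "q = (\<Sum>x\<in>basis n. \<Sum>y\<in>basis n.
      cnj (poly_mapping.lookup v x) * M x y * poly_mapping.lookup v y)"
  have "cnj q = q"
    unfolding q_def by (rule hermitian_form_cnj[OF assms])
  then have "Im q = 0"
    by (simp add: complex_eq_iff)
  have "(\<Sum>x\<in>basis n. \<Sum>y\<in>basis n. cnj (poly_mapping.lookup v x) * (- \<i> * M x y) * poly_mapping.lookup v y)
      = - \<i> * q"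
    unfolding q_def sum_distrib_left by (intro sum.cong refl) (simp only: ac_simps)
  then have "v \<bullet> mat_op n (\<lambda>x y. - \<i> * M x y) v = Re (- \<i> * q)"
    unfolding inner_commute[of v] inner_mat_op by (simp only:)
  then show "v \<bullet> mat_op n (\<lambda>x y. - \<i> * M x y) v = 0"
    using \<open>Im q = 0\<close> by simp
qed

section \<open>Local operators\<close>

text \<open>\<open>A\<close> changes a label only on \<open>S\<close> and \<open>B\<close> only on
  \<open>S'\<close>, so disjointness leaves a single intermediate state: \<open>x\<close> off
  \<open>S\<close> and \<open>y\<close> on \<open>S\<close>. The entry is then a product of two
  independent factors, and its symmetry gives commutation.\<close>

lemma mat_mul_local:
  assumes A: "\<And>x y. x \<in> basis n \<Longrightarrow> y \<in> basis n \<Longrightarrow>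
      A x y = (if x - S = y - S then k (x \<inter> S) (y \<inter> S) else 0)"
    and B: "\<And>x y. x \<in> basis n \<Longrightarrow> y \<in> basis n \<Longrightarrow>
      B x y = (if x - S' = y - S' then k' (x \<inter> S') (y \<inter> S') else 0)"
    and S: "S \<inter> S' = {}" and xy: "x \<in> basis n" "y \<in> basis n"
  shows "mat_mul n A B x y =
    (if x - (S \<union> S') = y - (S \<union> S') then k (x \<inter> S) (y \<inter> S) * k' (x \<inter> S') (y \<inter> S') else 0)"
proof -
  define z0 where "z0 = (x - S) \<union> (y \<inter> S)"
  have z0: "z0 \<in> basis n"
    using xy by (auto simp: z0_def basis_def)
  have zero: "A x z * B z y = 0" if z: "z \<in> basis n" "z \<noteq> z0" for z
  proof (rule ccontr)
    assume "A x z * B z y \<noteq> 0"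
    then have "x - S = z - S" "z - S' = y - S'"
      using A[OF xy(1) z(1)] B[OF z(1) xy(2)] by (auto split: if_splits)
    then have "z = z0"
      unfolding z0_def using S by blast
    then show False
      using z by simp
  qed
  have "mat_mul n A B x y = (\<Sum>z\<in>{z0}. A x z * B z y)"
    unfolding mat_mul_def using z0 zero by (intro sum.mono_neutral_right finite_basis) blast+
  moreover have "x - S = z0 - S" "x \<inter> S' = z0 \<inter> S'" "y \<inter> S = z0 \<inter> S"
    "z0 - S' = y - S' \<longleftrightarrow> x - (S \<union> S') = y - (S \<union> S')"
    unfolding z0_def using S by blast+
  ultimately show ?thesis
    using A[OF xy(1) z0] B[OF z0 xy(2)] by simp
qed

lemma comm_mat_op_local:
  assumes A: "acts_only_on n S A" and B: "acts_only_on n S' B" and S: "S \<inter> S' = {}"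
  shows "comm (mat_op n A) (mat_op n B) = 0"
proof -
  obtain k k' where k: "\<And>x y. x \<in> basis n \<Longrightarrow> y \<in> basis n \<Longrightarrow>
      A x y = (if x - S = y - S then k (x \<inter> S) (y \<inter> S) else 0)"
    and k': "\<And>x y. x \<in> basis n \<Longrightarrow> y \<in> basis n \<Longrightarrow>
      B x y = (if x - S' = y - S' then k' (x \<inter> S') (y \<inter> S') else 0)"
    using A B unfolding acts_only_on_def by metis
  have "S' \<inter> S = {}"
    using S by blast
  then have "mat_op n (mat_mul n A B) = mat_op n (mat_mul n B A)"
    by (intro mat_op_cong) (simp add: mat_mul_local[OF k k' S] mat_mul_local[OF k' k] Un_commute mult.commute)
  then show ?thesis
    by (simp add: comm_def mat_op_compose)
qed

text \<open>Being supported on \<open>X\<close> is expressed by commuting with every operator supported off \<open>X\<close>, since a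
  centralizer is closed under the algebra operations without further argument.\<close>

definition ops_off :: "nat \<Rightarrow> nat set \<Rightarrow> ((nat set \<Rightarrow>\<^sub>0 complex) \<Rightarrow>\<^sub>L (nat set \<Rightarrow>\<^sub>0 complex)) set"
  where "ops_off n X = {mat_op n M |M Y. acts_only_on n Y M \<and> Y \<inter> X = {}}"

lemma mat_op_in_ops_off: "acts_only_on n Y M \<Longrightarrow> Y \<inter> X = {} \<Longrightarrow> mat_op n M \<in> ops_off n X"
  by (auto simp: ops_off_def)

lemma mat_op_in_centralizer: "acts_only_on n X M \<Longrightarrow> mat_op n M \<in> centralizer (ops_off n X)"
  by (auto simp: ops_off_def centralizer_def intro: comm_mat_op_local)

section \<open>Product states\<close>

text \<open>The matrix of the rank-one projection onto the state \<open>s i\<close> of qubit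
  \<open>i\<close>, tensored with the identity on the other qubits; it is idempotent when
  \<open>s i\<close> is normalized.\<close>

definition site_proj :: "(nat \<Rightarrow> bool \<Rightarrow> complex) \<Rightarrow> nat \<Rightarrow> nat set \<Rightarrow> nat set \<Rightarrow> complex"
  where "site_proj s i = (\<lambda>x y. if x - {i} = y - {i} then s i (i \<in> x) * cnj (s i (i \<in> y)) else 0)"

lemma acts_only_on_site_proj: "acts_only_on n {i} (site_proj s i)"
  unfolding acts_only_on_def site_proj_def
  by (rule exI[of _ "\<lambda>a b. s i (i \<in> a) * cnj (s i (i \<in> b))"]) simp

lemma hermitian_site_proj: "hermitian n (site_proj s i)"
  by (simp add: hermitian_def site_proj_def)

text \<open>With the label fixed away from qubit \<open>i\<close>, only the two values of that qubit
  remain.\<close>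

lemma sum_basis_site:
  fixes F :: "nat set \<Rightarrow> complex"
  assumes "i < n" "x \<in> basis n"
  shows "(\<Sum>z\<in>basis n. if x - {i} = z - {i} then F z else 0) = F (x - {i}) + F (insert i x)"
proof -
  have "(\<Sum>z\<in>basis n. if x - {i} = z - {i} then F z else 0) = (\<Sum>z\<in>{z \<in> basis n. x - {i} = z - {i}}. F z)"
    by (simp add: sum.inter_filter finite_basis)
  also have "{z \<in> basis n. x - {i} = z - {i}} = {x - {i}, insert i x}"
  proof (intro equalityI subsetI)
    fix z assume "z \<in> {z \<in> basis n. x - {i} = z - {i}}"
    then have "z = (if i \<in> z then insert i x else x - {i})"
      by (cases "i \<in> z") auto
    then show "z \<in> {x - {i}, insert i x}"
      by (metis insertCI)
  qed (use assms in \<open>auto simp: basis_def\<close>)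
  also have "(\<Sum>z\<in>{x - {i}, insert i x}. F z) = F (x - {i}) + F (insert i x)"
    by (subst sum.insert) auto
  finally show ?thesis .
qed

lemma qubit_normalized:
  assumes "(cmod a)\<^sup>2 + (cmod b)\<^sup>2 = 1"
  shows "a * cnj a + b * cnj b = 1"
  using assms by (metis complex_norm_square of_real_1 of_real_add)

lemma mat_mul_site_proj:
  assumes i: "i < n" and s: "(cmod (s i False))\<^sup>2 + (cmod (s i True))\<^sup>2 = 1"
    and xy: "x \<in> basis n" "y \<in> basis n"
  shows "mat_mul n (site_proj s i) (site_proj s i) x y = site_proj s i x y"
proof -
  define F where "F = (\<lambda>z. s i (i \<in> x) * cnj (s i (i \<in> z)) * site_proj s i z y)"
  have "mat_mul n (site_proj s i) (site_proj s i) x y = (\<Sum>z\<in>basis n. if x - {i} = z - {i} then F z else 0)"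
    unfolding mat_mul_def by (intro sum.cong) (auto simp: F_def site_proj_def)
  also have "\<dots> = F (x - {i}) + F (insert i x)"
    by (rule sum_basis_site[OF i xy(1)])
  also have "\<dots> = (s i False * cnj (s i False) + s i True * cnj (s i True)) * site_proj s i x y"
    by (simp add: F_def site_proj_def algebra_simps)
  also have "s i False * cnj (s i False) + s i True * cnj (s i True) = 1"
    using s by (rule qubit_normalized)
  finally show ?thesis
    by simp
qed

lemma orth_proj_site_proj:
  assumes "i < n" "(cmod (s i False))\<^sup>2 + (cmod (s i True))\<^sup>2 = 1"
  shows "orth_proj (mat_op n (site_proj s i))"
  unfolding orth_proj_def
proof (intro conjI allI)
  fix v w
  show "mat_op n (site_proj s i) v \<bullet> w = v \<bullet> mat_op n (site_proj s i) w"
    by (rule inner_mat_op_hermitian[OF hermitian_site_proj])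
  have "mat_op n (site_proj s i) o\<^sub>L mat_op n (site_proj s i) = mat_op n (site_proj s i)"
    unfolding mat_op_compose by (intro mat_op_cong mat_mul_site_proj assms)
  then show "mat_op n (site_proj s i) (mat_op n (site_proj s i) v) = mat_op n (site_proj s i) v"
    by (metis blinfun_apply_blinfun_compose)
qed

text \<open>At \<open>k = n\<close> this is the rank-one projection onto the product state, which
  turns the Efron-Stein inequality into a variance bound. The support condition on \<open>v\<close>
  makes the empty product, the full identity, agree with the identity matrix.\<close>

lemma proj_prod_site_proj:
  assumes "k \<le> n" "Poly_Mapping.keys v \<subseteq> basis n"
  shows "proj_prod (\<lambda>i. mat_op n (site_proj s i)) k v = mat_op n (\<lambda>x y.
    if x - {..<k} = y - {..<k} then \<Prod>i<k. s i (i \<in> x) * cnj (s i (i \<in> y)) else 0) v"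
  using assms
proof (induction k arbitrary: v)
  case 0
  then show ?case
    using mat_op_id_apply[OF 0(2)] by (simp add: id_mat_def cong: if_cong)
next
  case (Suc k)
  define K where "K = (\<lambda>x y. if x - {..<k} = y - {..<k} then \<Prod>i<k. s i (i \<in> x) * cnj (s i (i \<in> y)) else 0)"
  have "proj_prod (\<lambda>i. mat_op n (site_proj s i)) (Suc k) v
      = (mat_op n K o\<^sub>L mat_op n (site_proj s k)) v"
    using Suc by (simp add: keys_mat_op K_def)
  also have "mat_op n K o\<^sub>L mat_op n (site_proj s k) = mat_op n (\<lambda>x y.
    if x - {..<Suc k} = y - {..<Suc k} then \<Prod>i<Suc k. s i (i \<in> x) * cnj (s i (i \<in> y)) else 0)"
    unfolding mat_op_compose
  proof (rule mat_op_cong)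
    fix x y assume xy: "x \<in> basis n" "y \<in> basis n"
    have "mat_mul n K (site_proj s k) x y = (if x - ({..<k} \<union> {k}) = y - ({..<k} \<union> {k})
      then (\<Prod>i<k. s i (i \<in> x \<inter> {..<k}) * cnj (s i (i \<in> y \<inter> {..<k}))) *
        (s k (k \<in> x \<inter> {k}) * cnj (s k (k \<in> y \<inter> {k}))) else 0)"
      by (rule mat_mul_local) (use xy in \<open>auto simp: K_def site_proj_def intro!: prod.cong\<close>)
    moreover have "{..<k} \<union> {k} = {..<Suc k}"
      by auto
    ultimately show "mat_mul n K (site_proj s k) x y =
        (if x - {..<Suc k} = y - {..<Suc k} then \<Prod>i<Suc k. s i (i \<in> x) * cnj (s i (i \<in> y)) else 0)"
      by simp
  qed
  finally show ?case .
qed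

definition vec_of :: "nat \<Rightarrow> (nat set \<Rightarrow> complex) \<Rightarrow> (nat set \<Rightarrow>\<^sub>0 complex)"
  where "vec_of n f = (\<Sum>x\<in>basis n. Poly_Mapping.single x (f x))"

lemma lookup_vec_of: "poly_mapping.lookup (vec_of n f) x = (if x \<in> basis n then f x else 0)"
  by (simp add: vec_of_def lookup_sum lookup_single when_def finite_basis)

lemma keys_vec_of: "Poly_Mapping.keys (vec_of n f) \<subseteq> basis n"
  by (auto simp: in_keys_iff lookup_vec_of split: if_splits)

lemma mat_vec_lookup_vec_of: "mat_vec n M (poly_mapping.lookup (vec_of n f)) = mat_vec n M f"
  by (auto simp: mat_vec_def lookup_vec_of intro!: sum.cong)

text \<open>The sum over labels is the expansion over subsets of the product of the single-qubit
  squared norms, each equal to \<open>1\<close>.\<close>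

lemma norm_product_state:
  assumes "\<And>i. i < n \<Longrightarrow> (cmod (s i False))\<^sup>2 + (cmod (s i True))\<^sup>2 = 1"
  shows "norm (vec_of n (product_state n s)) = 1"
proof -
  have "(norm (vec_of n (product_state n s)))\<^sup>2 = (\<Sum>x\<in>Pow {..<n}. (cmod (\<Prod>i<n. s i (i \<in> x)))\<^sup>2)"
    unfolding norm_poly_mapping_square[OF keys_vec_of]
    by (simp add: lookup_vec_of basis_def product_state_def)
  also have "\<dots> = (\<Sum>x\<in>Pow {..<n}. (\<Prod>i\<in>x. (cmod (s i True))\<^sup>2) * (\<Prod>i\<in>{..<n} - x. (cmod (s i False))\<^sup>2))"
  proof (rule sum.cong[OF refl])
    fix x assume "x \<in> Pow {..<n}"
    then have "(\<Prod>i<n. s i (i \<in> x)) = (\<Prod>i\<in>x. s i (i \<in> x)) * (\<Prod>i\<in>{..<n} - x. s i (i \<in> x))"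
      by (metis PowD finite_lessThan mult.commute prod.subset_diff)
    also have "\<dots> = (\<Prod>i\<in>x. s i True) * (\<Prod>i\<in>{..<n} - x. s i False)"
      by (intro arg_cong2[of _ _ _ _ "(*)"] prod.cong) auto
    finally show "(cmod (\<Prod>i<n. s i (i \<in> x)))\<^sup>2
        = (\<Prod>i\<in>x. (cmod (s i True))\<^sup>2) * (\<Prod>i\<in>{..<n} - x. (cmod (s i False))\<^sup>2)"
      by (simp add: norm_mult power_mult_distrib prod_power_distrib flip: prod_norm)
  qed
  also have "\<dots> = (\<Prod>i<n. (cmod (s i True))\<^sup>2 + (cmod (s i False))\<^sup>2)"
    by (simp add: prod_add)
  also have "\<dots> = 1"
    using assms by (simp add: add.commute)
  finally show ?thesis
    by (intro power2_eq_imp_eq[of _ 1]) simp_all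
qed

lemma site_proj_product_state:
  assumes i: "i < n" and s: "(cmod (s i False))\<^sup>2 + (cmod (s i True))\<^sup>2 = 1"
  shows "mat_op n (site_proj s i) (vec_of n (product_state n s)) = vec_of n (product_state n s)"
proof (rule poly_mapping_eqI)
  fix x
  have "mat_vec n (site_proj s i) (product_state n s) x = product_state n s x" if x: "x \<in> basis n"
  proof -
    define F where "F = (\<lambda>z. s i (i \<in> x) * cnj (s i (i \<in> z)) * product_state n s z)"
    define R where "R = (\<Prod>j\<in>{..<n} - {i}. s j (j \<in> x))"
    have split: "product_state n s z = s i (i \<in> z) * R" if "x - {i} = z - {i}" for z
    proof -
      have "j \<in> z \<longleftrightarrow> j \<in> x" if "j \<noteq> i" for j
        using that \<open>x - {i} = z - {i}\<close> by blast
      then show ?thesis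
        unfolding product_state_def R_def using i
        by (subst prod.remove[of _ i]) (auto intro!: prod.cong)
    qed
    have "mat_vec n (site_proj s i) (product_state n s) x
        = (\<Sum>z\<in>basis n. if x - {i} = z - {i} then F z else 0)"
      unfolding mat_vec_def by (intro sum.cong) (auto simp: F_def site_proj_def)
    also have "\<dots> = F (x - {i}) + F (insert i x)"
      by (rule sum_basis_site[OF i x])
    also have "\<dots> = (s i False * cnj (s i False) + s i True * cnj (s i True)) * (s i (i \<in> x) * R)"
      by (simp add: F_def split algebra_simps)
    also have "s i False * cnj (s i False) + s i True * cnj (s i True) = 1"
      using s by (rule qubit_normalized)
    finally show ?thesis
      by (simp add: split)
  qed
  then show "poly_mapping.lookup (mat_op n (site_proj s i) (vec_of n (product_state n s))) x
      = poly_mapping.lookup (vec_of n (product_state n s)) x"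
    by (simp add: lookup_mat_op mat_vec_lookup_vec_of lookup_vec_of)
qed

lemma acts_only_on_pauliZ: "acts_only_on n {i} (pauliZ i)"
  unfolding acts_only_on_def pauliZ_def
  by (rule exI[of _ "\<lambda>a b. if a = b then if i \<in> a then - 1 else 1 else 0"]) auto

lemma norm_pauliZ_le: "norm (mat_op n (pauliZ i)) \<le> 1"
proof (rule norm_blinfun_bound)
  fix v :: "nat set \<Rightarrow>\<^sub>0 complex"
  have "cmod (mat_vec n (pauliZ i) (poly_mapping.lookup v) x) = cmod (poly_mapping.lookup v x)"
    if "x \<in> basis n" for x
    using that by (simp add: mat_vec_def pauliZ_def finite_basis if_distrib[of "\<lambda>z. z * _"] cong: if_cong)
  then have "(norm (mat_op n (pauliZ i) v))\<^sup>2 = (vnorm n (poly_mapping.lookup v))\<^sup>2"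
    unfolding norm_poly_mapping_square[OF keys_mat_op] by (simp add: lookup_mat_op vnorm_def sum_nonneg)
  then have "norm (mat_op n (pauliZ i) v) = vnorm n (poly_mapping.lookup v)"
    by (rule power2_eq_imp_eq) (simp_all add: vnorm_def sum_nonneg)
  then show "norm (mat_op n (pauliZ i) v) \<le> 1 * norm v"
    by (simp add: vnorm_lookup_le)
qed simp

section \<open>Unitary evolution\<close>

text \<open>Gronwall for the norm, which starts at zero. It serves as uniqueness for linear
  equations and needs no completeness of the space.\<close>

lemma linear_ode_zero:
  fixes D :: "real \<Rightarrow> 'a::real_normed_vector"
  assumes T: "0 \<le> T" and a: "0 \<le> a" and D0: "D 0 = 0"
    and deriv: "\<And>t. t \<in> {0..T} \<Longrightarrow> (D has_vector_derivative L t) (at t within {0..T})"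
    and L: "\<And>t. t \<in> {0..T} \<Longrightarrow> norm (L t) \<le> a * norm (D t)"
  shows "D T = 0"
proof -
  have "norm (D T) \<le> norm (D 0) * exp (a * T)"
  proof (rule dini_gronwall[OF _ T _ _ a])
    have "continuous_on {0..T} D"
      unfolding continuous_on_eq_continuous_within
      using deriv has_vector_derivative_continuous by blast
    then show "continuous_on {0..T} (\<lambda>t. norm (D t))"
      by (rule continuous_on_norm)
    fix s \<epsilon> :: real
    assume s: "0 \<le> s" "s < T" and \<epsilon>: "0 < \<epsilon>"
    then have sT: "s \<in> {0..T}"
      by simp
    obtain \<delta> where \<delta>: "\<delta> > 0" and \<delta>D: "\<And>y. y \<in> {0..T} \<Longrightarrow> norm (y - s) < \<delta> \<Longrightarrow>
        norm (D y - D s - (y - s) *\<^sub>R L s) \<le> \<epsilon> * norm (y - s)"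
      using deriv[OF sT] \<epsilon> unfolding has_vector_derivative_def has_derivative_within_alt by blast
    have "norm (D (s + h)) \<le> norm (D s) + h * (a * norm (D s) + \<epsilon>)"
      if h: "0 < h" "h < \<delta>" "s + h \<le> T" for h
    proof -
      have "norm (D (s + h) - D s - h *\<^sub>R L s) \<le> \<epsilon> * h"
        using \<delta>D[of "s + h"] h s by simp
      moreover have "norm (h *\<^sub>R L s) \<le> h * (a * norm (D s))"
        using L[OF sT] h by simp
      moreover have "D (s + h) = D s + h *\<^sub>R L s + (D (s + h) - D s - h *\<^sub>R L s)"
        by simp
      then have "norm (D (s + h)) \<le> norm (D s) + norm (h *\<^sub>R L s) + norm (D (s + h) - D s - h *\<^sub>R L s)"
        by (metis norm_triangle_ineq norm_triangle_mono order_refl)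
      ultimately show ?thesis
        by (simp add: algebra_simps)
    qed
    with \<delta> show "\<exists>d>0. \<forall>h. 0 < h \<and> h < d \<and> s + h \<le> T \<longrightarrow>
        norm (D (s + h)) \<le> norm (D s) + h * (a * norm (D s) + \<epsilon>)"
      by blast
  qed simp
  then show ?thesis
    using D0 by simp
qed

text \<open>The derivative of the squared norm is twice the quadratic form of the skew generator,
  hence zero.\<close>

lemma evolution_norm:
  fixes V :: "real \<Rightarrow> ('a::real_inner \<Rightarrow>\<^sub>L 'a)"
  assumes T: "0 \<le> T"
    and deriv: "\<And>t. t \<in> {0..T} \<Longrightarrow> (V has_vector_derivative S t o\<^sub>L V t) (at t within {0..T})"
    and skew: "\<And>t. t \<in> {0..T} \<Longrightarrow> skew (S t)"
  shows "norm (V T v) = norm (V 0 v)"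
proof -
  have "((\<lambda>t. V t v \<bullet> V t v) has_vector_derivative 0) (at t within {0..T})" if t: "t \<in> {0..T}" for t
  proof -
    have "((\<lambda>t. V t v) has_vector_derivative S t (V t v)) (at t within {0..T})"
      using bounded_linear.has_vector_derivative[OF blinfun.bounded_linear_left deriv[OF t], of v]
      by simp
    from bounded_bilinear.has_vector_derivative[OF bounded_bilinear_inner this this]
    show ?thesis
      using skew[OF t] by (simp add: skew_def inner_commute[of "S t (V t v)"])
  qed
  then obtain c where "\<And>t. t \<in> {0..T} \<Longrightarrow> V t v \<bullet> V t v = c"
    using has_vector_derivative_zero_constant[of "{0..T}" "\<lambda>t. V t v \<bullet> V t v"] by auto
  then show ?thesis
    using T by (simp add: norm_eq_sqrt_inner)
qed

text \<open>Preservation of norms alone gives no right inverse. The defect \<open>D\<close>, the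
  difference between \<open>V t o W t\<close> and \<open>J\<close>, satisfies
  \<open>D' = comm (S t) D\<close> because \<open>S t\<close> commutes with \<open>J\<close>, and it
  starts at zero.\<close>

lemma evolution_inverse:
  fixes V W :: "real \<Rightarrow> ('a::real_normed_vector \<Rightarrow>\<^sub>L 'a)"
  assumes T: "0 \<le> T" and k: "\<And>t. t \<in> {0..T} \<Longrightarrow> norm (S t) \<le> k"
    and V: "\<And>t. t \<in> {0..T} \<Longrightarrow> (V has_vector_derivative S t o\<^sub>L V t) (at t within {0..T})"
    and W: "\<And>t. t \<in> {0..T} \<Longrightarrow> (W has_vector_derivative - (W t o\<^sub>L S t)) (at t within {0..T})"
    and init: "V 0 o\<^sub>L W 0 = J" and J: "\<And>t. t \<in> {0..T} \<Longrightarrow> comm (S t) J = 0"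
  shows "V T o\<^sub>L W T = J"
proof -
  have "(V T o\<^sub>L W T) - J = 0"
  proof (rule linear_ode_zero[where D = "\<lambda>t. (V t o\<^sub>L W t) - J" and a = "2 * k" and L = "\<lambda>t. comm (S t) ((V t o\<^sub>L W t) - J)"])
    show "0 \<le> 2 * k"
      using k[of 0] T norm_ge_zero[of "S 0"] by (smt (verit) atLeastAtMost_iff)
    fix t assume t: "t \<in> {0..T}"
    have "((\<lambda>t. (V t o\<^sub>L W t) - J) has_vector_derivative
        ((V t o\<^sub>L - (W t o\<^sub>L S t)) + ((S t o\<^sub>L V t) o\<^sub>L W t)) - 0) (at t within {0..T})"
      by (intro has_vector_derivative_diff has_vector_derivative_const
          bounded_bilinear.has_vector_derivative[OF bounded_bilinear_blinfun_compose] V W t)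
    moreover have "((V t o\<^sub>L - (W t o\<^sub>L S t)) + ((S t o\<^sub>L V t) o\<^sub>L W t)) - 0 = comm (S t) ((V t o\<^sub>L W t) - J)"
      unfolding comm_diff_right J[OF t]
      by (rule blinfun_eqI) (simp add: comm_apply blinfun.bilinear_simps)
    ultimately show "((\<lambda>t. (V t o\<^sub>L W t) - J) has_vector_derivative comm (S t) ((V t o\<^sub>L W t) - J)) (at t within {0..T})"
      by simp
    show "norm (comm (S t) ((V t o\<^sub>L W t) - J)) \<le> 2 * k * norm ((V t o\<^sub>L W t) - J)"
      using k[OF t] by (intro order_trans[OF norm_comm_le] mult_right_mono) auto
  qed (use T init in auto)
  then show ?thesis
    by simp
qed

section \<open>Magnetization and Hamming weight\<close>

lemma sum_pauli_sign:
  assumes "x \<in> basis n"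
  shows "(\<Sum>i<n. if i \<in> x then - 1 else 1 :: real) = real n - 2 * real (card x)"
proof -
  have x: "x \<subseteq> {..<n}"
    using assms by (simp add: basis_def)
  then have fin: "finite x" and le: "card x \<le> n"
    by (auto intro: finite_subset dest: card_mono[rotated])
  have "(\<Sum>i<n. if i \<in> x then - 1 else 1 :: real) = (\<Sum>i\<in>{..<n} - x. 1) + (\<Sum>i\<in>x. - 1)"
    using x by (subst sum.subset_diff[of x]) auto
  also have "\<dots> = (real n - real (card x)) - real (card x)"
    using x fin le by (simp add: card_Diff_subset of_nat_diff)
  finally show ?thesis
    by simp
qed

lemma lookup_sum_pauliZ:
  "poly_mapping.lookup ((\<Sum>i<n. mat_op n (pauliZ i)) v) x =
    (if x \<in> basis n then complex_of_real (real n - 2 * real (card x)) * poly_mapping.lookup v x else 0)"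
proof (cases "x \<in> basis n")
  case True
  have "mat_vec n (pauliZ i) f x = complex_of_real (if i \<in> x then - 1 else 1) * f x" for i f
    using True by (simp add: mat_vec_def pauliZ_def finite_basis if_distrib[of "\<lambda>z. z * _"] cong: if_cong)
  then have "poly_mapping.lookup ((\<Sum>i<n. mat_op n (pauliZ i)) v) x
      = complex_of_real (\<Sum>i<n. if i \<in> x then - 1 else 1) * poly_mapping.lookup v x"
    using True by (simp add: blinfun.sum_left lookup_sum lookup_mat_op sum_distrib_right of_real_sum)
  then show ?thesis
    using True by (simp add: sum_pauli_sign)
qed (simp add: blinfun.sum_left lookup_sum lookup_mat_op)

lemma sum_expval_pauliZ:
  "Re (\<Sum>i<n. expval n (pauliZ i) f) = (\<Sum>x\<in>basis n. (cmod (f x))\<^sup>2 * (real n - 2 * real (card x)))"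
proof -
  have "Re (expval n (pauliZ i) f) = (\<Sum>x\<in>basis n. (cmod (f x))\<^sup>2 * (if i \<in> x then - 1 else 1))" for i
  proof -
    have "expval n (pauliZ i) f = (\<Sum>x\<in>basis n. cnj (f x) * (if i \<in> x then - 1 else 1) * f x)"
      unfolding expval_def
      by (intro sum.cong refl)
        (simp add: pauliZ_def finite_basis if_distrib[of "\<lambda>z. _ * z"] if_distrib[of "\<lambda>z. z * _"] cong: if_cong)
    also have "\<dots> = (\<Sum>x\<in>basis n. complex_of_real ((cmod (f x))\<^sup>2 * (if i \<in> x then - 1 else 1)))"
      by (intro sum.cong refl) (auto simp: complex_norm_square mult.commute simp del: of_real_power)
    finally show ?thesis
      by (simp only: Re_sum Re_complex_of_real)
  qed
  then have "Re (\<Sum>i<n. expval n (pauliZ i) f)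
      = (\<Sum>x\<in>basis n. (cmod (f x))\<^sup>2 * (\<Sum>i<n. if i \<in> x then - 1 else 1))"
    by (simp only: Re_sum sum_distrib_left) (rule sum.swap)
  also have "\<dots> = (\<Sum>x\<in>basis n. (cmod (f x))\<^sup>2 * (real n - 2 * real (card x)))"
    by (intro sum.cong refl) (simp only: sum_pauli_sign)
  finally show ?thesis .
qed

text \<open>Chebyshev for the magnetization \<open>n - 2 * card x\<close>, whose deviation from
  \<open>m\<close> is twice that of the Hamming weight; hence the factor \<open>4\<close>. The
  second moment may be taken about any complex \<open>z\<close>: dropping the imaginary part and
  moving the real part to the mean can only decrease it.\<close>

lemma hamming_weight_chebyshev:
  fixes f :: "nat set \<Rightarrow> complex" and z :: complex
  assumes unit: "(\<Sum>x\<in>basis n. (cmod (f x))\<^sup>2) = 1"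
    and var: "(\<Sum>x\<in>basis n. (cmod (complex_of_real (real n - 2 * real (card x)) * f x - z * f x))\<^sup>2) \<le> Q"
    and m: "m = Re (\<Sum>i<n. expval n (pauliZ i) f)" and \<tau>: "0 < \<tau>"
  shows "(\<Sum>x\<in>{x\<in>basis n. \<bar>real (card x) - (real n / 2 - m / 2)\<bar> \<ge> \<tau>}. (cmod (f x))\<^sup>2) \<le> Q / (4 * \<tau>\<^sup>2)"
proof -
  define p where "p = (\<lambda>x. (cmod (f x))\<^sup>2)"
  define a where "a = (\<lambda>x :: nat set. real n - 2 * real (card x))"
  have mean: "(\<Sum>x\<in>basis n. p x * a x) = m" and tot: "(\<Sum>x\<in>basis n. p x) = 1"
    unfolding m sum_expval_pauliZ p_def a_def using unit by simp_all
  define r where "r = Re z"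
  \<comment> \<open>The second moment about \<open>r\<close> is the variance plus
    \<open>(m - r)\<^sup>2\<close>. The inserted cross term vanishes because \<open>m\<close> is the
    mean and the weights sum to \<open>1\<close>.\<close>
  have "(\<Sum>x\<in>basis n. p x * (a x - m)\<^sup>2) + (m - r)\<^sup>2
      = (\<Sum>x\<in>basis n. p x * (a x - m)\<^sup>2) + 2 * (m - r) * ((\<Sum>x\<in>basis n. p x * a x) - m * (\<Sum>x\<in>basis n. p x))
        + (m - r)\<^sup>2 * (\<Sum>x\<in>basis n. p x)"
    using mean tot by simp
  also have "\<dots> = (\<Sum>x\<in>basis n. p x * (a x - r)\<^sup>2)"
    by (simp add: sum_distrib_left right_diff_distrib sum_subtractf[symmetric] sum.distrib[symmetric])
      (intro sum.cong refl, simp add: power2_eq_square algebra_simps)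
  also have "\<dots> \<le> (\<Sum>x\<in>basis n. (cmod (complex_of_real (a x) * f x - z * f x))\<^sup>2)"
  proof (rule sum_mono)
    fix x
    have "(a x - r)\<^sup>2 \<le> (cmod (complex_of_real (a x) - z))\<^sup>2"
      using abs_Re_le_cmod[of "complex_of_real (a x) - z"]
      by (simp add: r_def abs_le_square_iff[symmetric])
    then show "p x * (a x - r)\<^sup>2 \<le> (cmod (complex_of_real (a x) * f x - z * f x))\<^sup>2"
      unfolding left_diff_distrib[symmetric] norm_mult power_mult_distrib p_def
      by (subst mult.commute) (intro mult_right_mono; simp)
  qed
  finally have Q: "(\<Sum>x\<in>basis n. p x * (a x - m)\<^sup>2) \<le> Q"
    using var by (simp add: a_def) (smt (verit) zero_le_power2)
  define B where "B = {x\<in>basis n. \<bar>real (card x) - (real n / 2 - m / 2)\<bar> \<ge> \<tau>}"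
  have "(4 * \<tau>\<^sup>2) * (\<Sum>x\<in>B. p x) = (\<Sum>x\<in>B. p x * (2 * \<tau>)\<^sup>2)"
    unfolding sum_distrib_left by (intro sum.cong refl) (simp add: power2_eq_square)
  also have "\<dots> \<le> (\<Sum>x\<in>B. p x * (a x - m)\<^sup>2)"
  proof (intro sum_mono mult_left_mono)
    fix x assume "x \<in> B"
    then have "\<bar>2 * \<tau>\<bar> \<le> \<bar>a x - m\<bar>"
      using \<tau> by (auto simp: B_def a_def)
    then show "(2 * \<tau>)\<^sup>2 \<le> (a x - m)\<^sup>2"
      by (simp only: abs_le_square_iff)
  qed (simp add: p_def)
  also have "\<dots> \<le> (\<Sum>x\<in>basis n. p x * (a x - m)\<^sup>2)"
    by (intro sum_mono2 finite_basis) (auto simp: B_def p_def)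
  finally show ?thesis
    using Q \<tau> by (simp add: B_def p_def field_simps)
qed

section \<open>Degree bounds\<close>

lemma simple_graph_finite: "simple_graph n E \<Longrightarrow> finite E"
  by (rule finite_subset[of _ "Pow {..<n}"]) (auto simp: simple_graph_def)

lemma degree_le_max_degree: "v < n \<Longrightarrow> Defs.degree E v \<le> max_degree n E"
  unfolding max_degree_def by (intro Max_ge) auto

text \<open>Each endpoint of an edge lies on at most \<Delta> - 1 other edges. A single vertex lies
  on at most \<Delta> edges, and \<Delta> is at most 2 (\<Delta> - 1) because \<Delta> > 1.\<close>

lemma card_boundary_le:
  assumes G: "simple_graph n E" and \<Delta>: "max_degree n E > 1"
    and X: "X \<in> E \<union> (\<lambda>i. {i}) ` {..<n}"
  shows "card {e \<in> E. e \<inter> X \<noteq> {} \<and> e \<noteq> X} \<le> 2 * (max_degree n E - 1)"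
proof -
  note fin = simple_graph_finite[OF G]
  show ?thesis
  proof (cases "X \<in> E")
    case True
    then obtain a b where ab: "a < n" "b < n" "X = {a, b}"
      using G by (auto simp: simple_graph_def)
    have side: "card ({e \<in> E. v \<in> e} - {X}) \<le> max_degree n E - 1" if "v \<in> X" for v
      using that True ab fin degree_le_max_degree[of v n E]
      by (subst card_Diff_singleton) (auto simp: Defs.degree_def diff_le_mono)
    have "card {e \<in> E. e \<inter> X \<noteq> {} \<and> e \<noteq> X}
        \<le> card (({e \<in> E. a \<in> e} - {X}) \<union> ({e \<in> E. b \<in> e} - {X}))"
      using fin ab by (intro card_mono) auto
    also have "\<dots> \<le> card ({e \<in> E. a \<in> e} - {X}) + card ({e \<in> E. b \<in> e} - {X})"
      by (rule card_Un_le)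
    also have "\<dots> \<le> (max_degree n E - 1) + (max_degree n E - 1)"
      using ab by (intro add_mono side) auto
    finally show ?thesis
      by simp
  next
    case False
    then obtain i where i: "i < n" "X = {i}"
      using X by auto
    have "card {e \<in> E. e \<inter> X \<noteq> {} \<and> e \<noteq> X} \<le> Defs.degree E i"
      unfolding Defs.degree_def using fin i by (intro card_mono) auto
    also have "\<dots> \<le> max_degree n E"
      using i by (intro degree_le_max_degree)
    finally show ?thesis
      using \<Delta> by simp
  qed
qed

section \<open>The concentration bound\<close>

text \<open>Since \<open>\<kappa> < 1\<close>, the exponent \<open>(2 - \<kappa>) / \<kappa>\<close>
  is at least \<open>1\<close>, so the power of \<Delta> dominates \<Delta>. The logarithmic factor
  enters through \<open>ln y \<le> y - 1\<close> at \<open>y = 1 / \<Delta>\<close>.\<close>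

lemma light_cone_exponent:
  fixes \<Delta> :: nat
  assumes \<Delta>: "\<Delta> > 1" and g: "0 < g" and T: "0 \<le> T" and \<kappa>: "0 < \<kappa>" "\<kappa> < 1"
    and bound: "T \<le> \<kappa> / (8 * g * real \<Delta> powr ((2 - \<kappa>) / \<kappa>) * ln (real \<Delta>)) * ln (real n)"
  shows "8 * g * (real \<Delta> - 1) * T \<le> \<kappa> * ln (real n)"
proof -
  define q where "q = real \<Delta> powr ((2 - \<kappa>) / \<kappa>)"
  have ln: "0 < ln (real \<Delta>)"
    using \<Delta> by simp
  have "real \<Delta> powr 1 \<le> q"
    unfolding q_def using \<Delta> \<kappa> by (intro powr_mono) (auto simp: field_simps)
  then have q: "real \<Delta> \<le> q"
    using \<Delta> by simp
  have "ln (1 / real \<Delta>) \<le> 1 / real \<Delta> - 1"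
    using \<Delta> by (intro ln_le_minus_one) simp
  then have "real \<Delta> - 1 \<le> real \<Delta> * ln (real \<Delta>)"
    using \<Delta> by (simp add: ln_div field_simps)
  also have "\<dots> \<le> q * ln (real \<Delta>)"
    using q ln by (intro mult_right_mono) auto
  finally have "8 * g * (real \<Delta> - 1) * T \<le> 8 * g * (q * ln (real \<Delta>)) * T"
    using g T by (intro mult_right_mono mult_left_mono) auto
  also have "\<dots> \<le> \<kappa> * ln (real n)"
  proof -
    have "0 < 8 * g * q * ln (real \<Delta>)"
      using g ln q \<Delta> by (intro mult_pos_pos) auto
    then show ?thesis
      using bound unfolding q_def[symmetric] by (simp add: field_simps)
  qed
  finally show ?thesis .
qed

text \<open>Only the Pauli operators on sites of \<open>X\<close> fail to commute with
  \<open>A\<close>, and each contributes at most \<open>2\<close>. For edges and single vertices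
  this gives the initial constant \<open>4\<close>.\<close>

lemma magnetization_commutator_le:
  assumes A: "A \<in> centralizer (ops_off n X)" "norm A \<le> 1" and X: "finite X"
  shows "norm (comm A (\<Sum>i<n. mat_op n (pauliZ i))) \<le> 2 * card X"
proof -
  have zero: "comm A (mat_op n (pauliZ i)) = 0" if "i \<notin> X" for i
    using A(1) mat_op_in_ops_off[OF acts_only_on_pauliZ, of i X n] that
    by (auto simp: centralizer_def)
  have "norm (comm A (\<Sum>i<n. mat_op n (pauliZ i))) \<le> (\<Sum>i<n. norm (comm A (mat_op n (pauliZ i))))"
    unfolding comm_sum_right by (rule norm_sum)
  also have "\<dots> = (\<Sum>i\<in>{..<n} \<inter> X. norm (comm A (mat_op n (pauliZ i))))"
    by (rule sum.mono_neutral_right) (auto simp: zero)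
  also have "\<dots> \<le> (\<Sum>i\<in>{..<n} \<inter> X. 2)"
    using norm_comm_contraction_le[OF A(2)] norm_pauliZ_le
    by (intro sum_mono) (smt (verit))
  also have "\<dots> \<le> 2 * card X"
    using X by (simp add: card_mono)
  finally show ?thesis
    by simp
qed

text \<open>Time reversal: \<open>B (T - t)\<close> solves the same equation with generators
  \<open>- S e (T - t)\<close>, which have the same supports, norms and skewness. This form is
  needed because the observable is known to be local at the final time.\<close>

lemma commutator_growth_backward:
  fixes S :: "'i set \<Rightarrow> real \<Rightarrow> ('a::real_inner \<Rightarrow>\<^sub>L 'a)"
    and C :: "'i set \<Rightarrow> ('a \<Rightarrow>\<^sub>L 'a) set"
  assumes fin: "finite E" and EF: "E \<subseteq> F" and T: "0 \<le> T" and g: "0 < g"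
    and off: "\<And>e X t. e \<in> E \<Longrightarrow> X \<in> F \<Longrightarrow> e \<inter> X = {} \<Longrightarrow> t \<in> {0..T} \<Longrightarrow> S e t \<in> C X"
    and C: "\<And>X A. X \<in> F \<Longrightarrow> A \<in> C X \<Longrightarrow> - A \<in> C X"
    and on: "\<And>e t. e \<in> E \<Longrightarrow> t \<in> {0..T} \<Longrightarrow> S e t \<in> centralizer (C e)"
    and skew: "\<And>e t. e \<in> E \<Longrightarrow> t \<in> {0..T} \<Longrightarrow> skew (S e t)"
    and bound: "\<And>e t. e \<in> E \<Longrightarrow> t \<in> {0..T} \<Longrightarrow> norm (S e t) \<le> g"
    and boundary: "\<And>X. X \<in> F \<Longrightarrow> card {e \<in> E. e \<inter> X \<noteq> {} \<and> e \<noteq> X} \<le> d"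
    and deriv: "\<And>t. t \<in> {0..T} \<Longrightarrow>
      (B has_vector_derivative comm (\<Sum>e\<in>E. S e t) (B t)) (at t within {0..T})"
    and final: "\<And>X A. X \<in> F \<Longrightarrow> A \<in> centralizer (C X) \<Longrightarrow> norm A \<le> 1 \<Longrightarrow> norm (comm A (B T)) \<le> M"
    and X: "X \<in> F" and A: "A \<in> centralizer (C X)" "norm A \<le> 1"
  shows "norm (comm A (B 0)) \<le> M * exp (2 * g * d * T)"
proof -
  have "norm (comm A (B (T - T))) \<le> M * exp (2 * g * d * T)"
  proof (rule commutator_growth[where S = "\<lambda>e t. - S e (T - t)" and B = "\<lambda>t. B (T - t)", OF fin EF T g])
    fix t assume t: "t \<in> {0..T}"
    have im: "(\<lambda>t. T - t) ` {0..T} = {0..T}"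
      by (auto intro: image_eqI[of _ _ "T - _"])
    have "((\<lambda>t. T - t) has_vector_derivative - 1) (at t within {0..T})"
      by (auto intro!: derivative_eq_intros)
    from vector_diff_chain_within[OF this, of B "comm (\<Sum>e\<in>E. S e (T - t)) (B (T - t))"]
    show "((\<lambda>t. B (T - t)) has_vector_derivative comm (\<Sum>e\<in>E. - S e (T - t)) (B (T - t))) (at t within {0..T})"
      using deriv[of "T - t"] t comm_scaleR_left[of "- 1" "\<Sum>e\<in>E. S e (T - t)" "B (T - t)"]
      by (simp add: im o_def sum_negf)
  next
    fix e t assume "e \<in> E" "t \<in> {0..T}"
    then show "- S e (T - t) \<in> centralizer (C e)"
      using centralizer_scaleR[OF on[of e "T - t"], of "- 1"] by simp
  qed (use off C skew_uminus[OF skew] bound boundary final X A in auto)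
  then show ?thesis
    by simp
qed

theorem theorem2:
  fixes n :: nat and E :: "nat set set" and \<Delta> :: nat
    and h :: "nat set \<Rightarrow> nat set \<Rightarrow> nat set \<Rightarrow> complex"
    and u :: "nat set \<Rightarrow> real \<Rightarrow> real"
    and H U :: "real \<Rightarrow> nat set \<Rightarrow> nat set \<Rightarrow> complex"
    and s :: "nat \<Rightarrow> bool \<Rightarrow> complex"
    and g T \<kappa>\<^sub>1 \<kappa>\<^sub>2 c :: real
  assumes graph: "simple_graph n E"
    and Delta: "\<Delta> = max_degree n E" "\<Delta> > 1"
    and h_local: "\<And>e. e \<in> E \<Longrightarrow> acts_only_on n e (h e)"
    and h_herm: "\<And>e. e \<in> E \<Longrightarrow> hermitian n (h e)"
    and H_def: "\<And>t. H t = (\<lambda>x y. \<Sum>e\<in>E. complex_of_real (u e t) * h e x y)"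
    and g_pos: "g > 0"
    and bound: "\<And>e t. e \<in> E \<Longrightarrow> 0 \<le> t \<Longrightarrow> t \<le> T \<Longrightarrow>
                  opnorm n (\<lambda>x y. complex_of_real (u e t) * h e x y) \<le> g"
    and T_nonneg: "0 \<le> T"
    and U0: "\<And>x y. x \<in> basis n \<Longrightarrow> y \<in> basis n \<Longrightarrow> U 0 x y = id_mat x y"
    and U_ode: "\<And>t x y. t \<in> {0..T} \<Longrightarrow> x \<in> basis n \<Longrightarrow> y \<in> basis n \<Longrightarrow>
                  ((\<lambda>\<tau>. U \<tau> x y) has_vector_derivative
                     (- \<i> * mat_mul n (H t) (U t) x y)) (at t within {0..T})"
    and s_norm: "\<And>i. i < n \<Longrightarrow> (cmod (s i False))\<^sup>2 + (cmod (s i True))\<^sup>2 = 1"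
    and kappa1: "0 < \<kappa>\<^sub>1" "\<kappa>\<^sub>1 < 1"
    and T_bound: "T \<le> \<kappa>\<^sub>1 / (8 * g * real \<Delta> powr ((2 - \<kappa>\<^sub>1) / \<kappa>\<^sub>1) * ln (real \<Delta>))
                      * ln (real n)"
    and c_pos: "c > 0"
    and kappa2: "\<kappa>\<^sub>1 / 2 < \<kappa>\<^sub>2" "\<kappa>\<^sub>2 < 1 / 2"
  shows "let \<psi>T = mat_vec n (U T) (product_state n s);
             p = (\<lambda>x. (cmod (\<psi>T x))\<^sup>2);
             m = Re (\<Sum>i<n. expval n (pauliZ i) \<psi>T)
         in (\<Sum>x\<in>{x\<in>basis n. \<bar>real (card x) - (real n / 2 - m / 2)\<bar>
                                 \<ge> c * real n powr (1/2 + \<kappa>\<^sub>2)}. p x)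
            \<le> 3 / (2 * c\<^sup>2) * real n powr (- (2 * \<kappa>\<^sub>2 - \<kappa>\<^sub>1))"
proof -
  define \<psi> where "\<psi> = vec_of n (product_state n s)"
  define V where "V = (\<lambda>t. mat_op n (U t))"
  define W where "W = (\<lambda>t. mat_op n (\<lambda>x y. cnj (U t y x)))"
  define S where "S = (\<lambda>e t. mat_op n (\<lambda>x y. - \<i> * (complex_of_real (u e t) * h e x y)))"
  \<comment> \<open>The identity on the register, in place of \<open>id_blinfun\<close>, which also
    acts on labels outside \<open>basis n\<close>.\<close>
  define J where "J = mat_op n id_mat"
  define Z where "Z = (\<Sum>i<n. mat_op n (pauliZ i))"
  define A where "A = W T o\<^sub>L Z o\<^sub>L V T"
  define F where "F = E \<union> (\<lambda>i. {i}) ` {..<n}"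
  note finE = simple_graph_finite[OF graph]
  have n: "0 < n"
    using Delta by (cases "n = 0") (auto simp: max_degree_def)
  have \<psi>: "norm \<psi> = 1"
    unfolding \<psi>_def using s_norm by (rule norm_product_state)

  \<comment> \<open>Local skew generators\<close>
  have H_herm: "H t y x = cnj (H t x y)" if "x \<in> basis n" "y \<in> basis n" for t x y
  proof -
    have "h e y x = cnj (h e x y)" if "e \<in> E" for e
      using h_herm[OF that] \<open>x \<in> basis n\<close> \<open>y \<in> basis n\<close> unfolding hermitian_def by blast
    then show ?thesis
      by (simp add: H_def)
  qed
  have term_herm: "hermitian n (\<lambda>x y. complex_of_real (u e t) * h e x y)" if "e \<in> E" for e t
    using h_herm[OF that] unfolding hermitian_def by (metis complex_cnj_complex_of_real complex_cnj_mult)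
  have S_sum: "(\<Sum>e\<in>E. S e t) = mat_op n (\<lambda>x y. - \<i> * H t x y)" for t
    by (simp add: S_def H_def sum_distrib_left flip: mat_op_sum)
  have S_skew: "skew (S e t)" if "e \<in> E" for e t
    unfolding S_def by (rule skew_mat_op[OF term_herm[OF that]])
  have S_bound: "norm (S e t) \<le> g" if "e \<in> E" "t \<in> {0..T}" for e t
    unfolding S_def using bound[OF that(1)] that(2) g_pos by (intro norm_mat_op_le) auto
  have S_local: "acts_only_on n e (\<lambda>x y. - \<i> * (complex_of_real (u e t) * h e x y))" if e: "e \<in> E" for e t
  proof -
    obtain k where "\<forall>x\<in>basis n. \<forall>y\<in>basis n. h e x y = (if x - e = y - e then k (x \<inter> e) (y \<inter> e) else 0)"
      using h_local[OF e] unfolding acts_only_on_def by blast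
    then show ?thesis
      unfolding acts_only_on_def
      by (intro exI[of _ "\<lambda>a b. - \<i> * (complex_of_real (u e t) * k a b)"]) simp
  qed

  \<comment> \<open>The evolution and its adjoint\<close>
  have V_deriv: "(V has_vector_derivative (\<Sum>e\<in>E. S e t) o\<^sub>L V t) (at t within {0..T})"
    if t: "t \<in> {0..T}" for t
  proof -
    have "(\<Sum>e\<in>E. S e t) o\<^sub>L V t = mat_op n (\<lambda>x y. - \<i> * mat_mul n (H t) (U t) x y)"
      unfolding S_sum V_def mat_op_compose
      by (rule mat_op_cong) (simp add: mat_mul_def sum_distrib_left mult.assoc)
    then show ?thesis
      unfolding V_def using U_ode[OF t] by (simp add: mat_op_has_vector_derivative)
  qed
  have W_deriv: "(W has_vector_derivative - (W t o\<^sub>L (\<Sum>e\<in>E. S e t))) (at t within {0..T})"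
    if t: "t \<in> {0..T}" for t
  proof -
    \<comment> \<open>Taking adjoints reverses the product, and Hermiticity of \<open>H t\<close>
      brings the generator back up to its sign.\<close>
    have "- (W t o\<^sub>L (\<Sum>e\<in>E. S e t)) = mat_op n (\<lambda>x y. cnj (- \<i> * mat_mul n (H t) (U t) y x))"
      unfolding S_sum W_def mat_op_compose mat_op_uminus[symmetric]
    proof (rule mat_op_cong)
      fix x y assume "x \<in> basis n" "y \<in> basis n"
      then have "H t z y = cnj (H t y z)" if "z \<in> basis n" for z
        using that by (intro H_herm)
      then show "- mat_mul n (\<lambda>x y. cnj (U t y x)) (\<lambda>x y. - \<i> * H t x y) x y
          = cnj (- \<i> * mat_mul n (H t) (U t) y x)"
        unfolding mat_mul_def cnj_sum complex_cnj_mult sum_distrib_left sum_negf[symmetric]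
        by (intro sum.cong refl) simp
    qed
    moreover have "(W has_vector_derivative mat_op n (\<lambda>x y. cnj (- \<i> * mat_mul n (H t) (U t) y x)))
        (at t within {0..T})"
      unfolding W_def
      by (intro mat_op_has_vector_derivative has_vector_derivative_cnj U_ode[OF t])
    ultimately show ?thesis
      by simp
  qed
  have V0: "V 0 = J"
    unfolding V_def J_def by (rule mat_op_cong) (rule U0)
  have W0: "W 0 = J"
    unfolding W_def J_def by (rule mat_op_cong) (simp add: U0 id_mat_def)
  have J_id: "J o\<^sub>L mat_op n M = mat_op n M" "mat_op n M o\<^sub>L J = mat_op n M" for M
    unfolding J_def by (rule mat_op_id_left mat_op_id_right)+
  have Z_J: "J o\<^sub>L Z = Z" "Z o\<^sub>L J = Z"
  proof -
    have "Z = mat_op n (\<lambda>x y. \<Sum>i<n. pauliZ i x y)"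
      by (simp add: Z_def mat_op_sum)
    then show "J o\<^sub>L Z = Z" "Z o\<^sub>L J = Z"
      by (simp_all add: J_id)
  qed
  have VW: "V T o\<^sub>L W T = J"
  proof (rule evolution_inverse[OF T_nonneg _ V_deriv W_deriv])
    show "norm (\<Sum>e\<in>E. S e t) \<le> card E * g" if "t \<in> {0..T}" for t
      using S_bound that by (intro sum_norm_bound) auto
    show "V 0 o\<^sub>L W 0 = J"
      unfolding V0 W0 unfolding J_def by (rule mat_op_id_left)
    show "comm (\<Sum>e\<in>E. S e t) J = 0" for t
      by (simp add: S_sum comm_def J_id)
  qed
  have V_norm: "norm (V T v) = norm (J v)" for v
    using evolution_norm[OF T_nonneg V_deriv, of v] S_skew V0 by (simp add: skew_sum)

  \<comment> \<open>Commutators of the Heisenberg observable\<close>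
  define B where "B = (\<lambda>t. V t o\<^sub>L A o\<^sub>L W t)"
  \<comment> \<open>The fixed operator \<open>A\<close> is carried along, reaching \<open>Z\<close>
    at time \<open>T\<close>, so the equation involves the local generators themselves. Varying the
    final time in the Heisenberg operator would instead conjugate them by the evolution.\<close>
  have B_deriv: "(B has_vector_derivative comm (\<Sum>e\<in>E. S e t) (B t)) (at t within {0..T})"
    if t: "t \<in> {0..T}" for t
  proof -
    have "(B has_vector_derivative ((V t o\<^sub>L A) o\<^sub>L - (W t o\<^sub>L (\<Sum>e\<in>E. S e t)))
        + ((V t o\<^sub>L 0) + (((\<Sum>e\<in>E. S e t) o\<^sub>L V t) o\<^sub>L A) o\<^sub>L W t)) (at t within {0..T})"
      unfolding B_def
      by (intro bounded_bilinear.has_vector_derivative[OF bounded_bilinear_blinfun_compose]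
          V_deriv W_deriv t has_vector_derivative_const)
    moreover have "((V t o\<^sub>L A) o\<^sub>L - (W t o\<^sub>L (\<Sum>e\<in>E. S e t)))
        + ((V t o\<^sub>L 0) + (((\<Sum>e\<in>E. S e t) o\<^sub>L V t) o\<^sub>L A) o\<^sub>L W t) = comm (\<Sum>e\<in>E. S e t) (B t)"
      by (rule blinfun_eqI) (simp add: B_def comm_apply blinfun.bilinear_simps)
    ultimately show ?thesis
      by simp
  qed
  have B0: "B 0 = A"
  proof (rule blinfun_eqI)
    fix v
    have "J (W T w) = W T w" "V T (J w) = V T w" for w
      using J_id unfolding V_def W_def by (metis blinfun_apply_blinfun_compose)+
    then show "B 0 v = A v"
      by (simp add: B_def V0 W0 A_def)
  qed
  have BT: "B T = Z"
  proof -
    have "B T = (V T o\<^sub>L W T) o\<^sub>L Z o\<^sub>L (V T o\<^sub>L W T)"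
      by (rule blinfun_eqI) (simp add: B_def A_def)
    then show ?thesis
      by (simp add: VW Z_J)
  qed

  \<comment> \<open>\<open>2 * (\<Delta> - 1)\<close> bounds the number of crossing edges, each
    costing \<open>2 * g\<close>. The variance involves the square of \<open>exp X\<close>, and
    \<open>2 * X\<close> is the exponent \<open>8 * g * (\<Delta> - 1) * T\<close>.\<close>
  define X where "X = 2 * g * (2 * (\<Delta> - 1) :: nat) * T"
  have A_comm: "norm (comm K A) \<le> 4 * exp X"
    if i: "i < n" and K: "K \<in> centralizer (ops_off n {i})" "norm K \<le> 1" for i K
    unfolding X_def B0[symmetric]
  proof (rule commutator_growth_backward[where S = S and F = F and C = "ops_off n" and X = "{i}" and B = B,
        OF finE _ T_nonneg g_pos])
    show "E \<subseteq> F" "{i} \<in> F"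
      using i by (auto simp: F_def)
    show "S e t \<in> ops_off n Y" if "e \<in> E" "e \<inter> Y = {}" for e Y t
      unfolding S_def using S_local[OF that(1)] that(2) by (rule mat_op_in_ops_off)
    show "S e t \<in> centralizer (ops_off n e)" if "e \<in> E" for e t
      unfolding S_def using S_local[OF that] by (rule mat_op_in_centralizer)
    show "- Q \<in> ops_off n Y" if Q: "Q \<in> ops_off n Y" for Q Y
    proof -
      obtain M Y' k where "Q = mat_op n M" "Y' \<inter> Y = {}" and
        k: "\<forall>x\<in>basis n. \<forall>y\<in>basis n. M x y = (if x - Y' = y - Y' then k (x \<inter> Y') (y \<inter> Y') else 0)"
        using Q unfolding ops_off_def acts_only_on_def by blast
      moreover from k have "acts_only_on n Y' (\<lambda>x y. - M x y)"
        unfolding acts_only_on_def by (intro exI[of _ "\<lambda>a b. - k a b"]) simp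
      ultimately show ?thesis
        using mat_op_in_ops_off by (metis mat_op_uminus)
    qed
    show "card {e \<in> E. e \<inter> Y \<noteq> {} \<and> e \<noteq> Y} \<le> 2 * (\<Delta> - 1)" if "Y \<in> F" for Y
      unfolding Delta(1) using that Delta graph by (intro card_boundary_le) (auto simp: F_def)
    show "norm (comm P (B T)) \<le> 4" if "Y \<in> F" "P \<in> centralizer (ops_off n Y)" "norm P \<le> 1" for P Y
    proof -
      have "finite Y" "card Y \<le> 2"
        using that(1) graph by (auto simp: F_def simple_graph_def card_insert_if)
      then show ?thesis
        using magnetization_commutator_le[OF that(2,3)] unfolding BT Z_def by fastforce
    qed
  qed (use i K S_skew S_bound B_deriv in auto)

  \<comment> \<open>Variance in the initial product state\<close>
  define p where "p = (\<lambda>i. mat_op n (site_proj s i))"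
  have p_proj: "orth_proj (p i)" if "i < n" for i
    unfolding p_def using that s_norm by (intro orth_proj_site_proj)
  have increment: "norm (A \<psi> - p i (A \<psi>)) \<le> 2 * exp X" if i: "i < n" for i
  proof -
    have "id_blinfun \<in> centralizer (ops_off n {i})"
      by (simp add: centralizer_def comm_eq_0_iff)
    then have "2 *\<^sub>R p i + (- 1) *\<^sub>R id_blinfun \<in> centralizer (ops_off n {i})"
      unfolding p_def
      by (intro centralizer_add centralizer_scaleR mat_op_in_centralizer acts_only_on_site_proj)
    then have "norm (comm (2 *\<^sub>R p i - id_blinfun) A) \<le> 4 * exp X"
      using i norm_reflection_le[OF p_proj[OF i]] by (intro A_comm) auto
    \<comment> \<open>The reflection fixes \<open>\<psi>\<close> because \<open>p i\<close> does, so
      the commutator applied to \<open>\<psi>\<close> is \<open>-2\<close> times the part of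
      \<open>A \<psi>\<close> that \<open>p i\<close> removes.\<close>
    moreover have "A \<psi> - p i (A \<psi>) = (- 1 / 2) *\<^sub>R comm (2 *\<^sub>R p i - id_blinfun) A \<psi>"
    proof -
      have "p i \<psi> = \<psi>"
        unfolding p_def \<psi>_def using i s_norm by (intro site_proj_product_state)
      then show ?thesis
        by (simp add: comm_apply blinfun.bilinear_simps algebra_simps)
    qed
    moreover have "norm (comm (2 *\<^sub>R p i - id_blinfun) A \<psi>) \<le> norm (comm (2 *\<^sub>R p i - id_blinfun) A)"
      using norm_blinfun[of "comm (2 *\<^sub>R p i - id_blinfun) A" \<psi>] \<psi> by simp
    ultimately show ?thesis
      by simp
  qed
  have spread: "(norm (A \<psi> - proj_prod p n (A \<psi>)))\<^sup>2 \<le> real n * (2 * exp X)\<^sup>2"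
  proof -
    have "(norm (A \<psi> - proj_prod p n (A \<psi>)))\<^sup>2 \<le> (\<Sum>i<n. (norm (A \<psi> - p i (A \<psi>)))\<^sup>2)"
    proof (rule efron_stein[OF p_proj])
      show "comm (p i) (p j) = 0" if "i < j" "j < n" for i j
        unfolding p_def using that
        by (intro comm_mat_op_local[OF acts_only_on_site_proj acts_only_on_site_proj]) auto
    qed
    also have "\<dots> \<le> real (card {..<n}) * (2 * exp X)\<^sup>2"
      using increment by (intro sum_bounded_above power_mono) auto
    finally show ?thesis
      by simp
  qed

  \<comment> \<open>Transfer to the measured distribution\<close>
  define f where "f = mat_vec n (U T) (product_state n s)"
  \<comment> \<open>The expectation of \<open>A\<close> in the initial state, kept complex. The full
    product of site projections maps \<open>A \<psi>\<close> to \<open>z\<close> times that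
    state.\<close>
  define z where "z = (\<Sum>y\<in>basis n. cnj (product_state n s y) * poly_mapping.lookup (A \<psi>) y)"
  have V\<psi>: "poly_mapping.lookup (V T \<psi>) x = f x" if "x \<in> basis n" for x
    using that by (simp add: V_def \<psi>_def f_def lookup_mat_op mat_vec_lookup_vec_of)
  have keys_A: "Poly_Mapping.keys (A \<psi>) \<subseteq> basis n"
    by (simp add: A_def W_def keys_mat_op)
  have proj: "poly_mapping.lookup (proj_prod p n (A \<psi>)) x = z * product_state n s x"
    if x: "x \<in> basis n" for x
  proof -
    have "poly_mapping.lookup (proj_prod p n (A \<psi>)) x = (\<Sum>y\<in>basis n.
        (if x - {..<n} = y - {..<n} then \<Prod>i<n. s i (i \<in> x) * cnj (s i (i \<in> y)) else 0)
          * poly_mapping.lookup (A \<psi>) y)"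
      unfolding p_def proj_prod_site_proj[OF order_refl keys_A] using x
      by (simp add: lookup_mat_op mat_vec_def)
    also have "\<dots> = (\<Sum>y\<in>basis n. product_state n s x * (cnj (product_state n s y) * poly_mapping.lookup (A \<psi>) y))"
    proof (intro sum.cong refl)
      fix y assume "y \<in> basis n"
      then have "x - {..<n} = y - {..<n}"
        using x by (auto simp: basis_def)
      then show "(if x - {..<n} = y - {..<n} then \<Prod>i<n. s i (i \<in> x) * cnj (s i (i \<in> y)) else 0)
          * poly_mapping.lookup (A \<psi>) y
          = product_state n s x * (cnj (product_state n s y) * poly_mapping.lookup (A \<psi>) y)"
        by (simp add: product_state_def prod.distrib cnj_prod)
    qed
    finally show ?thesis
      by (simp add: z_def mult.commute flip: sum_distrib_left)
  qed
  \<comment> \<open>The evolution intertwines \<open>A\<close> with \<open>Z\<close>, so the vector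
    bounded above becomes, entry by entry, the deviation of the magnetization from \<open>z\<close>
    in the evolved state.\<close>
  have Vdiff: "poly_mapping.lookup (V T (A \<psi> - proj_prod p n (A \<psi>))) x
      = complex_of_real (real n - 2 * real (card x)) * f x - z * f x" if x: "x \<in> basis n" for x
  proof -
    have "V T (A \<psi>) = ((V T o\<^sub>L W T) o\<^sub>L Z) (V T \<psi>)"
      by (simp add: A_def)
    also have "\<dots> = Z (V T \<psi>)"
      by (simp only: VW Z_J)
    finally have "poly_mapping.lookup (V T (A \<psi>)) x = complex_of_real (real n - 2 * real (card x)) * f x"
      using x V\<psi>[OF x] by (simp add: Z_def lookup_sum_pauliZ)
    moreover have "poly_mapping.lookup (V T (proj_prod p n (A \<psi>))) x = z * f x"
      using x by (simp add: V_def f_def lookup_mat_op mat_vec_def proj sum_distrib_left mult.left_commute)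
    ultimately show ?thesis
      by (simp add: blinfun.diff_right lookup_minus)
  qed
  have var: "(\<Sum>x\<in>basis n. (cmod (complex_of_real (real n - 2 * real (card x)) * f x - z * f x))\<^sup>2)
      \<le> real n * (2 * exp X)\<^sup>2"
  proof -
    have "(\<Sum>x\<in>basis n. (cmod (complex_of_real (real n - 2 * real (card x)) * f x - z * f x))\<^sup>2)
        = (norm (V T (A \<psi> - proj_prod p n (A \<psi>))))\<^sup>2"
      unfolding V_def norm_poly_mapping_square[OF keys_mat_op] using Vdiff by (simp add: V_def)
    also have "\<dots> = (norm (A \<psi> - proj_prod p n (A \<psi>)))\<^sup>2"
    proof -
      have "Poly_Mapping.keys (proj_prod p n (A \<psi>)) \<subseteq> basis n"
        unfolding p_def proj_prod_site_proj[OF order_refl keys_A] by (rule keys_mat_op)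
      then have "J (A \<psi> - proj_prod p n (A \<psi>)) = A \<psi> - proj_prod p n (A \<psi>)"
        unfolding J_def blinfun.diff_right using keys_A by (simp only: mat_op_id_apply)
      then show ?thesis
        by (simp add: V_norm)
    qed
    finally show ?thesis
      using spread by simp
  qed
  have unit: "(\<Sum>x\<in>basis n. (cmod (f x))\<^sup>2) = 1"
  proof -
    have "(\<Sum>x\<in>basis n. (cmod (f x))\<^sup>2) = (norm (V T \<psi>))\<^sup>2"
      unfolding V_def norm_poly_mapping_square[OF keys_mat_op] using V\<psi> by (simp add: V_def)
    also have "norm (V T \<psi>) = 1"
      using V_norm[of \<psi>] \<psi> mat_op_id_apply[OF keys_vec_of] by (simp add: J_def \<psi>_def)
    finally show ?thesis
      by simp
  qed

  \<comment> \<open>The numerical tail bound\<close>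
  define \<tau> where "\<tau> = c * real n powr (1/2 + \<kappa>\<^sub>2)"
  have \<tau>: "0 < \<tau>"
    using c_pos n by (simp add: \<tau>_def)
  have "real n * (2 * exp X)\<^sup>2 / (4 * \<tau>\<^sup>2) \<le> 3 / (2 * c\<^sup>2) * real n powr (- (2 * \<kappa>\<^sub>2 - \<kappa>\<^sub>1))"
  proof -
    have "2 * X \<le> \<kappa>\<^sub>1 * ln (real n)"
      using light_cone_exponent[OF Delta(2) g_pos T_nonneg kappa1 T_bound] Delta(2)
      by (simp add: X_def of_nat_diff algebra_simps)
    then have "exp (2 * X) \<le> real n powr \<kappa>\<^sub>1"
      using n by (simp add: powr_def)
    then have "(exp X)\<^sup>2 \<le> real n powr \<kappa>\<^sub>1"
      by (simp add: exp_double)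
    moreover have "\<tau>\<^sup>2 = c\<^sup>2 * (real n * real n powr (2 * \<kappa>\<^sub>2))"
    proof -
      have "(real n powr (1/2 + \<kappa>\<^sub>2))\<^sup>2 = real n powr (1 + 2 * \<kappa>\<^sub>2)"
        by (simp add: power2_eq_square flip: powr_add)
      also have "\<dots> = real n * real n powr (2 * \<kappa>\<^sub>2)"
        using n by (simp add: powr_add)
      finally show ?thesis
        by (simp add: \<tau>_def power_mult_distrib)
    qed
    ultimately have "real n * (2 * exp X)\<^sup>2 / (4 * \<tau>\<^sup>2) \<le> 1 / c\<^sup>2 * (real n powr \<kappa>\<^sub>1 / real n powr (2 * \<kappa>\<^sub>2))"
      using n c_pos by (simp add: power_mult_distrib divide_simps)
    \<comment> \<open>The variance estimate gives the constant \<open>1\<close>, and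
      \<open>1 \<le> 3 / 2\<close>.\<close>
    also have "\<dots> \<le> 3 / (2 * c\<^sup>2) * (real n powr \<kappa>\<^sub>1 / real n powr (2 * \<kappa>\<^sub>2))"
      using c_pos by (intro mult_right_mono) (auto simp: divide_simps)
    finally show ?thesis
      by (simp add: powr_diff[symmetric])
  qed
  with hamming_weight_chebyshev[OF unit var refl \<tau>] show ?thesis
    unfolding Let_def f_def[symmetric] \<tau>_def[symmetric] by linarith
qed

end
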